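(* Let $z=(u,v,w)\in\mathcal{C}(\mathbb{R}^+;H^1(\mathbb{R})^3)$ be a weak solution of the three-component Camassa--Holm system which is $x$-symmetric, and suppose $z$ is the unique weak solution (i.e. any weak solution $\tilde z\in\mathcal{C}(\mathbb{R}^+;H^1(\mathbb{R})^3)$ with $\tilde z(t_0,\cdot)=z(t_0,\cdot)$ for some $t_0\ge0$ coincides with $z$). Then $z$ is a traveling wave, i.e. there exist $c\in\mathbb{R}$, $t_0\ge 0$ and a profile $Z$ such that $z(t,x)=Z(x-c(t-t_0))$ for all $t\ge0$ and a.e. $x$.
   Context: $\langle F,\phi\rangle=\int_{\mathbb{R}^+}\int_{\mathbb{R}}F\phi\,dx\,dt$. A function $z=(u,v,w)\in\mathcal{C}(\mathbb{R}^+;H^1(\mathbb{R})^3)$ is a weak solution if for all $\phi\in\mathcal{C}_0^\infty(\mathbb{R}^+\times\mathbb{R})$: $\langle u,(1-\partial_x^2)\phi_t\rangle+\langle u_x(v+w),\phi_{xx}\rangle-\frac12\langle u^2,\phi_{xxx}\rangle+\langle\frac32u^2+\frac12u_x^2+u(v+w)+u_x(v+w)_x+\frac12(v^2+w^2-v_x^2-w_x^2),\phi_x\rangle=0$, $\langle v,(1-\partial_x^2)\phi_t\rangle+\langle v_x(u+w),\phi_{xx}\rangle-\frac12\langle v^2,\phi_{xxx}\rangle+\langle\frac32v^2+\frac12v_x^2+v(u+w)+v_x(u+w)_x+\frac12(u^2+w^2-u_x^2-w_x^2),\phi_x\rangle=0$, $\langle w,(1-\partial_x^2)\phi_t\rangle+\langle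 w_x(u+v),\phi_{xx}\rangle-\frac12\langle w^2,\phi_{xxx}\rangle+\langle\frac32w^2+\frac12w_x^2+w(u+v)+w_x(u+v)_x+\frac12(u^2+v^2-u_x^2-v_x^2),\phi_x\rangle=0$. (This is the weak form of $m_t-m_xu+2mu_x+(mv+mw)_x+nv_x+lw_x=0$ and its two cyclic analogues, $m=u-u_{xx}$, $n=v-v_{xx}$, $l=w-w_{xx}$.) The solution $z$ is $x$-symmetric if there is $b\in\mathcal{C}^1(\mathbb{R}^+)$ such that $z(t,x)=z(t,2b(t)-x)$ for all $t\ge0$ and a.e. $x\in\mathbb{R}$. *)

theory Defs
  imports "HOL-Analysis.Analysis"
begin

definition L2 :: "(real \<Rightarrow> real) \<Rightarrow> bool" where
  "L2 f \<longleftrightarrow> f \<in> borel_measurable lborel \<and> integrable lborel (\<lambda>x. (f x)\<^sup>2)"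

definition test1 :: "(real \<Rightarrow> real) \<Rightarrow> bool" where
  "test1 \<phi> \<longleftrightarrow> (\<forall>k x. (deriv ^^ k) \<phi> differentiable (at x))
     \<and> (\<exists>K. compact K \<and> (\<forall>x. x \<notin> K \<longrightarrow> \<phi> x = 0))"

definition weak_deriv :: "(real \<Rightarrow> real) \<Rightarrow> (real \<Rightarrow> real) \<Rightarrow> bool" where
  "weak_deriv f g \<longleftrightarrow> (\<forall>\<phi>. test1 \<phi> \<longrightarrow>
     (LINT x|lborel. f x * deriv \<phi> x) = - (LINT x|lborel. g x * \<phi> x))"

definition H1 :: "(real \<Rightarrow> real) \<Rightarrow> (real \<Rightarrow> real) \<Rightarrow> bool" where
  "H1 f g \<longleftrightarrow> L2 f \<and> L2 g \<and> weak_deriv f g"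

definition CH1 :: "(real \<Rightarrow> real \<Rightarrow> real) \<Rightarrow> (real \<Rightarrow> real \<Rightarrow> real) \<Rightarrow> bool" where
  "CH1 u ux \<longleftrightarrow> (\<forall>t\<ge>0. H1 (u t) (ux t)) \<and>
     (\<forall>t\<ge>0. ((\<lambda>s. (LINT x|lborel. (u s x - u t x)\<^sup>2) + (LINT x|lborel. (ux s x - ux t x)\<^sup>2))
              \<longlongrightarrow> 0) (at t within {0..}))"

text \<open>Test functions in C_0^infinity(R^+ x R), phi t x.  D i j is the partial derivative
  d_t^i d_x^j phi; all of them exist and are continuous (hence phi is C^infinity), and phi
  has compact support in the open half-plane (0,infinity) x R.\<close>
definition test2 :: "(nat \<Rightarrow> nat \<Rightarrow> real \<Rightarrow> real \<Rightarrow> real) \<Rightarrow> bool" where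
  "test2 D \<longleftrightarrow>
     (\<forall>i j t x. ((\<lambda>s. D i j s x) has_real_derivative D (Suc i) j t x) (at t)
              \<and> ((\<lambda>y. D i j t y) has_real_derivative D i (Suc j) t x) (at x))
   \<and> (\<forall>i j. continuous_on UNIV (\<lambda>p. D i j (fst p) (snd p)))
   \<and> (\<exists>K. compact K \<and> K \<subseteq> {0<..} \<times> UNIV \<and> (\<forall>t x. (t, x) \<notin> K \<longrightarrow> D 0 0 t x = 0))"

definition pair :: "(real \<Rightarrow> real \<Rightarrow> real) \<Rightarrow> (real \<Rightarrow> real \<Rightarrow> real) \<Rightarrow> real" where
  "pair F \<phi> = (LINT t:{0..}|lborel. (LINT x|lborel. F t x * \<phi> t x))"

definition weak_eq ::
  "(real \<Rightarrow> real \<Rightarrow> real) \<Rightarrow> (real \<Rightarrow> real \<Rightarrow> real) \<Rightarrow> (real \<Rightarrow> real \<Rightarrow> real) \<Rightarrow>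
   (real \<Rightarrow> real \<Rightarrow> real) \<Rightarrow> (real \<Rightarrow> real \<Rightarrow> real) \<Rightarrow> (real \<Rightarrow> real \<Rightarrow> real) \<Rightarrow>
   (nat \<Rightarrow> nat \<Rightarrow> real \<Rightarrow> real \<Rightarrow> real) \<Rightarrow> bool" where
  "weak_eq a ax b bx c cx D \<longleftrightarrow>
     pair a (\<lambda>t x. D 1 0 t x - D 1 2 t x)
     + pair (\<lambda>t x. ax t x * (b t x + c t x)) (D 0 2)
     - 1/2 * pair (\<lambda>t x. (a t x)\<^sup>2) (D 0 3)
     + pair (\<lambda>t x. 3/2 * (a t x)\<^sup>2 + 1/2 * (ax t x)\<^sup>2 + a t x * (b t x + c t x)
                  + ax t x * (bx t x + cx t x)
                  + 1/2 * ((b t x)\<^sup>2 + (c t x)\<^sup>2 - (bx t x)\<^sup>2 - (cx t x)\<^sup>2)) (D 0 1)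
     = 0"

definition weak_solution ::
  "(real \<Rightarrow> real \<Rightarrow> real) \<Rightarrow> (real \<Rightarrow> real \<Rightarrow> real) \<Rightarrow> (real \<Rightarrow> real \<Rightarrow> real) \<Rightarrow> bool" where
  "weak_solution u v w \<longleftrightarrow> (\<exists>ux vx wx. CH1 u ux \<and> CH1 v vx \<and> CH1 w wx \<and>
     (\<forall>D. test2 D \<longrightarrow>
        weak_eq u ux v vx w wx D \<and> weak_eq v vx u ux w wx D \<and> weak_eq w wx u ux v vx D))"

definition x_symmetric ::
  "(real \<Rightarrow> real \<Rightarrow> real) \<Rightarrow> (real \<Rightarrow> real \<Rightarrow> real) \<Rightarrow> (real \<Rightarrow> real \<Rightarrow> real) \<Rightarrow> bool" where
  "x_symmetric u v w \<longleftrightarrow> (\<exists>b b'. continuous_on {0..} b'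
     \<and> (\<forall>t\<ge>0. (b has_real_derivative b' t) (at t within {0..}))
     \<and> (\<forall>t\<ge>0. AE x in lborel. u t x = u t (2 * b t - x) \<and> v t x = v t (2 * b t - x)
                              \<and> w t x = w t (2 * b t - x)))"

end

theory Submission
  imports Defs "HOL-Real_Asymp.Real_Asymp"
begin

text \<open>
  Testing the weak equation with products \<open>\<rho>(t) \<eta>(x)\<close> shows that
  \<open>t \<mapsto> \<langle>u(t), (1 - \<partial>\<^sub>x\<^sup>2) \<eta>\<rangle>\<close> is continuously differentiable with derivative
  the flux functional \<open>R(t, \<eta>)\<close>. By symmetry \<open>\<eta>\<close> may be replaced by its reflection in
  \<open>b(t)\<close> without changing this pairing. Differentiating the moving reflection at a single
  time \<open>t\<^sub>0 > 0\<close>, where the flux changes sign because \<open>u\<^sub>x\<close> is odd about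
  \<open>b(t\<^sub>0)\<close>, yields the stationary identity
  \<open>R(t\<^sub>0, \<eta>) = b'(t\<^sub>0) \<langle>u(t\<^sub>0), (1 - \<partial>\<^sub>x\<^sup>2) \<eta>'\<rangle>\<close>. It says exactly that
  \<open>u(t\<^sub>0, x - b'(t\<^sub>0) (t - t\<^sub>0))\<close> is a weak solution, so uniqueness identifies it with \<open>u\<close>.
  Only the derivative of \<open>b\<close> at \<open>t\<^sub>0\<close> enters, hence no regularized test functions
  \<open>\<phi>(t, 2 b(t) - x)\<close> are needed.
\<close>

subsection \<open>Smooth functions with compact support\<close>

text \<open>The obstacle is that the reflected test function moves with \<open>b(t)\<close>, while
  the weak equation controls only pairings with fixed functions and gives no time derivative of
  \<open>u\<close> itself. By the equation, the derivative is a difference of two fluxes that are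
  negatives of each other, hence twice one of them. By symmetry, the same quantity is
  \<open>u(t)\<close> paired with the difference of two translates of one function. That difference
  vanishes at \<open>t\<^sub>0\<close>, so continuity of \<open>u\<close> into L2 suffices, and the
  result is \<open>2 b'(t\<^sub>0)\<close> times a pairing with \<open>u(t\<^sub>0)\<close>. Three
  pieces of analysis support this: an explicit smooth step, which supplies cut-offs in time and the
  orthogonality lemma; uniqueness of weak derivatives, which transfers the symmetry to
  \<open>u_x\<close>; and continuity of translations in L2, without which the travelling wave would
  not be a candidate for the uniqueness hypothesis.\<close>

definition smooth_seq :: "(nat \<Rightarrow> real \<Rightarrow> real) \<Rightarrow> bool" where
  "smooth_seq d \<longleftrightarrow> (\<forall>k x. (d k has_real_derivative d (Suc k) x) (at x))"

text \<open>A test function is carried together with all its derivatives, so that the orders 1, 2, 3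
  occurring in the weak equation are terms and no iterated \<open>deriv\<close> has to be evaluated.
  One bound \<open>L\<close> serves all orders.\<close>

definition test_seq :: "(nat \<Rightarrow> real \<Rightarrow> real) \<Rightarrow> bool" where
  "test_seq d \<longleftrightarrow> smooth_seq d \<and> (\<exists>L. \<forall>k x. \<bar>x\<bar> > L \<longrightarrow> d k x = 0)"

lemma smooth_seq_DERIV: "smooth_seq d \<Longrightarrow> (d k has_real_derivative d (Suc k) x) (at x)"
  by (simp add: smooth_seq_def)

lemma smooth_seq_continuous: "smooth_seq d \<Longrightarrow> continuous_on UNIV (d k)"
  by (meson DERIV_isCont continuous_at_imp_continuous_on smooth_seq_DERIV)

lemma smooth_seq_measurable: "smooth_seq d \<Longrightarrow> d k \<in> borel_measurable borel"
  by (simp add: borel_measurable_continuous_onI smooth_seq_continuous)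

lemma smooth_seq_funpow_deriv:
  assumes "smooth_seq d" shows "(deriv ^^ k) (d 0) = d k"
proof (induction k)
  case (Suc k)
  then show ?case using smooth_seq_DERIV[OF assms, of k] by (auto intro!: ext DERIV_imp_deriv)
qed simp

lemma DERIV_eq_0_if_vanishing:
  fixes f :: "real \<Rightarrow> real"
  assumes "(f has_real_derivative D) (at x)" "open S" "x \<in> S" "\<And>y. y \<in> S \<Longrightarrow> f y = 0"
  shows "D = 0"
proof -
  have "((\<lambda>_. 0) has_real_derivative D) (at x)"
    by (rule has_field_derivative_transform_within_open[OF assms(1-3)]) (simp add: assms(4))
  then show ?thesis using DERIV_unique DERIV_const by blast
qed

lemma smooth_seq_vanishing:
  assumes "smooth_seq d" "open S" "\<And>x. x \<in> S \<Longrightarrow> d 0 x = 0" "x \<in> S"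
  shows "d k x = 0"
  using assms(4)
proof (induction k arbitrary: x)
  case (Suc k)
  then show ?case
    using DERIV_eq_0_if_vanishing[OF smooth_seq_DERIV[OF assms(1)] assms(2)] by metis
qed (use assms in auto)

text \<open>The region \<open>\<bar>x\<bar> > L\<close> is open, so vanishing of the function there
  forces vanishing of every derivative; only order 0 has to be checked.\<close>

lemma test_seqI:
  assumes "smooth_seq d" "\<And>x. \<bar>x\<bar> > L \<Longrightarrow> d 0 x = 0"
  shows "test_seq d"
proof -
  have "open {x::real. L < \<bar>x\<bar>}"
    by (intro open_Collect_less continuous_intros)
  then show ?thesis
    using smooth_seq_vanishing[OF assms(1), of "{x. L < \<bar>x\<bar>}"] assms unfolding test_seq_def by blast
qed

lemma test_seq_smooth: "test_seq d \<Longrightarrow> smooth_seq d"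
  by (simp add: test_seq_def)

lemma test_seq_support: 
  assumes "test_seq d" obtains L where "L > 0" "\<And>k x. \<bar>x\<bar> > L \<Longrightarrow> d k x = 0"
proof -
  obtain L where "\<forall>k x. \<bar>x\<bar> > L \<longrightarrow> d k x = 0" using assms unfolding test_seq_def by blast
  then show ?thesis using that[of "max L 1"] by auto
qed

lemma test_seq_imp_test1:
  assumes "test_seq d" shows "test1 (d 0)"
proof -
  obtain L where "L > 0" and L: "\<And>k x. \<bar>x\<bar> > L \<Longrightarrow> d k x = 0"
    by (rule test_seq_support[OF assms], rule that)
  have "\<forall>x. x \<notin> {-L..L} \<longrightarrow> d 0 x = 0" using L by (auto simp: abs_if)
  then show ?thesis
    unfolding test1_def
    by (metis assms compact_Icc real_differentiable_def smooth_seq_DERIV smooth_seq_funpow_deriv test_seq_smooth)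
qed

lemma test1_imp_test_seq:
  assumes "test1 \<phi>" shows "test_seq (\<lambda>k. (deriv ^^ k) \<phi>)"
proof -
  obtain K where K: "compact K" "\<forall>x. x \<notin> K \<longrightarrow> \<phi> x = 0"
    using assms test1_def by auto
  obtain L where L: "\<forall>x\<in>K. \<bar>x\<bar> \<le> L"
    using compact_imp_bounded[OF K(1)] by (auto simp: bounded_iff)
  have "smooth_seq (\<lambda>k. (deriv ^^ k) \<phi>)"
    using assms by (auto simp: smooth_seq_def test1_def DERIV_deriv_iff_real_differentiable)
  then show ?thesis
    by (rule test_seqI[where L=L]) (use K L in force)
qed

lemma test_seq_bounded:
  assumes "test_seq d" obtains M where "M > 0" "\<And>x. \<bar>d k x\<bar> \<le> M"
proof -
  obtain L where "L > 0" and L: "\<And>k x. \<bar>x\<bar> > L \<Longrightarrow> d k x = 0"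
    by (rule test_seq_support[OF assms], rule that)
  have "compact (d k ` {-L..L})"
    by (rule compact_continuous_image[OF _ compact_Icc])
       (use smooth_seq_continuous[OF test_seq_smooth[OF assms]] continuous_on_subset in blast)
  then obtain M where M: "\<forall>y \<in> d k ` {-L..L}. \<bar>y\<bar> \<le> M"
    using compact_imp_bounded by (force simp: bounded_iff)
  have "\<bar>d k x\<bar> \<le> max M 1" for x
    using M L[of x k] by (cases "\<bar>x\<bar> > L") (auto simp: abs_if le_max_iff_disj split: if_splits)
  then show ?thesis using that[of "max M 1"] by auto
qed

lemma smooth_seq_affine:
  assumes "smooth_seq d" shows "smooth_seq (\<lambda>k x. c ^ k * d k (a + c * x))"
  unfolding smooth_seq_def
proof (intro allI)
  fix k x
  have "((\<lambda>x. d k (a + c * x)) has_real_derivative d (Suc k) (a + c * x) * c) (at x)"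
    by (rule DERIV_chain2[OF smooth_seq_DERIV[OF assms]]) (auto intro!: derivative_eq_intros)
  from DERIV_cmult[OF this, of "c^k"]
  show "((\<lambda>x. c ^ k * d k (a + c * x)) has_real_derivative c ^ Suc k * d (Suc k) (a + c * x)) (at x)"
    by (simp add: mult_ac)
qed

lemma smooth_seq_diff:
  "smooth_seq d \<Longrightarrow> smooth_seq e \<Longrightarrow> smooth_seq (\<lambda>k x. d k x - e k x)"
  unfolding smooth_seq_def by (auto intro!: DERIV_diff)

lemma smooth_seq_Suc: "smooth_seq d \<Longrightarrow> smooth_seq (\<lambda>k. d (Suc k))"
  by (simp add: smooth_seq_def)

lemma test_seq_affine:
  assumes "test_seq d" "c \<noteq> 0" shows "test_seq (\<lambda>k x. c ^ k * d k (a + c * x))"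
proof -
  obtain L where "L > 0" and L: "\<And>k x. \<bar>x\<bar> > L \<Longrightarrow> d k x = 0"
    by (rule test_seq_support[OF assms(1)], rule that)
  show ?thesis
  proof (rule test_seqI[OF smooth_seq_affine[OF test_seq_smooth[OF assms(1)]], where L="(L + \<bar>a\<bar>) / \<bar>c\<bar>"])
    fix x assume "(L + \<bar>a\<bar>) / \<bar>c\<bar> < \<bar>x\<bar>"
    then have "L + \<bar>a\<bar> < \<bar>c * x\<bar>" using assms(2) by (simp add: abs_mult field_simps)
    then have "\<bar>a + c * x\<bar> > L" by linarith
    then show "c ^ 0 * d 0 (a + c * x) = 0" using L by simp
  qed
qed

lemma test_seq_Suc: "test_seq d \<Longrightarrow> test_seq (\<lambda>k. d (Suc k))"
  unfolding test_seq_def using smooth_seq_Suc by blast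

lemma test_seq_diff:
  assumes "test_seq d" "test_seq e" shows "test_seq (\<lambda>k x. d k x - e k x)"
proof -
  obtain L where L: "L > 0" "\<And>k x. \<bar>x\<bar> > L \<Longrightarrow> d k x = 0"
    by (rule test_seq_support[OF assms(1)], rule that)
  obtain M where M: "M > 0" "\<And>k x. \<bar>x\<bar> > M \<Longrightarrow> e k x = 0"
    by (rule test_seq_support[OF assms(2)], rule that)
  show ?thesis
  proof (rule test_seqI[where L="max L M"])
    show "smooth_seq (\<lambda>k x. d k x - e k x)"
      using assms by (intro smooth_seq_diff test_seq_smooth)
    show "d 0 x - e 0 x = 0" if "\<bar>x\<bar> > max L M" for x
      using that L(2)[of x 0] M(2)[of x 0] by simp
  qed
qed

subsection \<open>A smooth step function\<close>

text \<open>Smoothness order by order: the closure properties follow by induction on the order with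
  the function kept general, which avoids a Leibniz formula for the k-th derivative of a
  product.\<close>

fun times_differentiable :: "nat \<Rightarrow> (real \<Rightarrow> real) \<Rightarrow> bool" where
  "times_differentiable 0 f \<longleftrightarrow> True"
| "times_differentiable (Suc n) f \<longleftrightarrow>
     (\<exists>f'. (\<forall>x. (f has_real_derivative f' x) (at x)) \<and> times_differentiable n f')"

lemma times_differentiable_SucD: "times_differentiable (Suc n) f \<Longrightarrow> times_differentiable n f"
  by (induction n arbitrary: f) (simp, metis times_differentiable.simps(2))

lemma times_differentiable_const: "times_differentiable n (\<lambda>x. c)"
  by (induction n arbitrary: c) (auto intro!: exI[of _ "\<lambda>x. 0"])

lemma times_differentiable_add:
  "times_differentiable n f \<Longrightarrow> times_differentiable n g \<Longrightarrow> times_differentiable n (\<lambda>x. f x + g x)"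
proof (induction n arbitrary: f g)
  case (Suc n)
  then obtain f' g' where "\<forall>x. (f has_real_derivative f' x) (at x)" "times_differentiable n f'"
    "\<forall>x. (g has_real_derivative g' x) (at x)" "times_differentiable n g'" by auto
  then show ?case
    by (auto intro!: exI[of _ "\<lambda>x. f' x + g' x"] DERIV_add Suc.IH)
qed simp

lemma times_differentiable_mult:
  "times_differentiable n f \<Longrightarrow> times_differentiable n g \<Longrightarrow> times_differentiable n (\<lambda>x. f x * g x)"
proof (induction n arbitrary: f g)
  case (Suc n)
  then obtain f' g' where *: "\<forall>x. (f has_real_derivative f' x) (at x)" "times_differentiable n f'"
    "\<forall>x. (g has_real_derivative g' x) (at x)" "times_differentiable n g'" by auto
  have "times_differentiable n f" "times_differentiable n g"
    using Suc.prems times_differentiable_SucD by auto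
  with * have "times_differentiable n (\<lambda>x. f' x * g x + g' x * f x)"
    by (intro times_differentiable_add Suc.IH) auto
  then show ?case using * by (auto intro!: exI[of _ "\<lambda>x. f' x * g x + g' x * f x"] DERIV_mult)
qed simp

lemma times_differentiable_affine:
  "times_differentiable n f \<Longrightarrow> times_differentiable n (\<lambda>x. f (a + c * x))"
proof (induction n arbitrary: f)
  case (Suc n)
  then obtain f' where *: "\<forall>x. (f has_real_derivative f' x) (at x)" "times_differentiable n f'" by auto
  have "times_differentiable n (\<lambda>x. f' (a + c * x) * c)"
    by (rule times_differentiable_mult[OF Suc.IH[OF *(2)] times_differentiable_const])
  moreover have "((\<lambda>x. f (a + c * x)) has_real_derivative f' (a + c * x) * c) (at x)" for x
  proof -
    have "((\<lambda>x. a + c * x) has_real_derivative c) (at x)"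
      by (auto intro!: derivative_eq_intros)
    from DERIV_chain2[OF spec[OF *(1), of "a + c * x"] this] show ?thesis .
  qed
  ultimately show ?case by (auto intro!: exI[of _ "\<lambda>x. f' (a + c * x) * c"])
qed simp

text \<open>Passing to the derivative costs one order, so a function differentiable to every order
  has a derivative that is again differentiable to every order.\<close>

lemma smooth_seq_if_times_differentiable:
  assumes "\<And>n. times_differentiable n f"
  shows "smooth_seq (\<lambda>k. (deriv ^^ k) f)"
proof -
  have "times_differentiable n ((deriv ^^ k) f)" for n k
  proof (induction k arbitrary: n)
    case (Suc k)
    obtain f' where f': "\<forall>x. ((deriv ^^ k) f has_real_derivative f' x) (at x)" "times_differentiable n f'"
      using Suc[of "Suc n"] by auto
    then have "deriv ((deriv ^^ k) f) = f'" by (auto intro: DERIV_imp_deriv)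
    with f' show ?case by simp
  qed (use assms in auto)
  then have "times_differentiable (Suc 0) ((deriv ^^ k) f)" for k .
  then show ?thesis unfolding smooth_seq_def
    by (auto simp: DERIV_deriv_iff_real_differentiable real_differentiable_def)
qed

text \<open>\<open>flat 0\<close> is the classical smooth non-analytic function exp(-1/x), extended
  by 0. The negative powers are included so that the family is closed under differentiation up to
  linear combinations.\<close>

definition flat :: "nat \<Rightarrow> real \<Rightarrow> real" where
  "flat n x = (if x > 0 then (1 / x) ^ n * exp (- 1 / x) else 0)"

text \<open>At the origin the right difference quotient is a negative power times exp(-1/h) and
  tends to 0; elsewhere this is the product rule or the derivative of a constant.\<close>

lemma DERIV_flat:
  "(flat n has_real_derivative flat (n + 2) x - real n * flat (n + 1) x) (at x)"
proof (cases "x = 0")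
  case True
  have "((\<lambda>h. flat n h / h) \<longlongrightarrow> 0) (at_right 0)"
  proof (rule Lim_transform_eventually)
    show "\<forall>\<^sub>F h in at_right 0. (1 / h) ^ n * exp (- 1 / h) / h = flat n h / h"
      by (auto simp: flat_def eventually_at_right_less intro: eventually_mono[OF eventually_at_right_less])
    show "((\<lambda>h::real. (1 / h) ^ n * exp (- 1 / h) / h) \<longlongrightarrow> 0) (at_right 0)"
      by real_asymp
  qed
  moreover have "((\<lambda>h. flat n h / h) \<longlongrightarrow> 0) (at_left 0)"
  proof (rule Lim_transform_eventually)
    show "\<forall>\<^sub>F h in at_left 0. 0 = flat n h / h"
      by (rule eventually_mono[OF eventually_at_left_real[of "-1" 0]]) (auto simp: flat_def)
  qed simp
  ultimately have "((\<lambda>h. flat n h / h) \<longlongrightarrow> 0) (at 0)"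
    by (simp add: filterlim_at_split)
  then show ?thesis using True by (simp add: DERIV_def flat_def)
next
  case False
  show ?thesis
  proof (cases "x > 0")
    case True
    have inv: "((\<lambda>x. 1 / x) has_real_derivative - (1 / x)\<^sup>2) (at x)"
      using True by (auto intro!: derivative_eq_intros simp: power2_eq_square)
    have "((\<lambda>x. (1 / x) ^ n * exp (- (1 / x))) has_real_derivative
        real n * (- (1 / x)\<^sup>2 * (1 / x) ^ (n - Suc 0)) * exp (- (1 / x))
        + exp (- (1 / x)) * - (- (1 / x)\<^sup>2) * (1 / x) ^ n) (at x)"
      by (rule DERIV_mult[OF DERIV_power[OF inv] DERIV_chain2[OF DERIV_exp DERIV_minus[OF inv]]])
    also have "real n * (- (1 / x)\<^sup>2 * (1 / x) ^ (n - Suc 0)) * exp (- (1 / x))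
        + exp (- (1 / x)) * - (- (1 / x)\<^sup>2) * (1 / x) ^ n = flat (n + 2) x - real n * flat (n + 1) x"
      using True by (cases n) (simp_all add: flat_def power_add algebra_simps power2_eq_square)
    finally have "((\<lambda>x. (1 / x) ^ n * exp (- 1 / x)) has_real_derivative flat (n + 2) x - real n * flat (n + 1) x) (at x)"
      by simp
    then show ?thesis
      by (rule has_field_derivative_transform_within_open[of _ _ _ "{0<..}"]) (auto simp: True flat_def)
  next
    case False
    with \<open>x \<noteq> 0\<close> have "x < 0" by simp
    have "((\<lambda>x. 0) has_real_derivative 0) (at x)" by simp
    then have "(flat n has_real_derivative 0) (at x)"
      by (rule has_field_derivative_transform_within_open[of _ _ _ "{..<0}"]) (auto simp: \<open>x < 0\<close> flat_def)
    then show ?thesis using \<open>x < 0\<close> by (simp add: flat_def)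
  qed
qed

lemma times_differentiable_flat: "times_differentiable k (flat n)"
proof (induction k arbitrary: n)
  case (Suc k)
  have "times_differentiable k (\<lambda>x. flat (n + 2) x + (- real n) * flat (n + 1) x)"
    by (intro times_differentiable_add times_differentiable_mult times_differentiable_const Suc)
  then show ?case using DERIV_flat[of n] by (auto intro!: exI[of _ "\<lambda>x. flat (n + 2) x - real n * flat (n + 1) x"])
qed simp

text \<open>The step is the primitive of the bump \<open>\<beta>\<close>, a product of two flat
  functions facing each other at 0 and 1, divided by its total mass \<open>F 1\<close>.\<close>

lemma smooth_step:
  obtains d where "smooth_seq d" "\<And>x. x \<le> 0 \<Longrightarrow> d 0 x = 0" "\<And>x. x \<ge> 1 \<Longrightarrow> d 0 x = 1"
    "\<And>x. 0 \<le> d 0 x" "\<And>x. d 0 x \<le> 1" "\<And>x. d 1 x \<ge> 0"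
proof -
  define \<beta> where "\<beta> x = flat 0 x * flat 0 (1 + (-1) * x)" for x
  have beta_sm: "smooth_seq (\<lambda>k. (deriv ^^ k) \<beta>)"
    unfolding \<beta>_def
    by (intro smooth_seq_if_times_differentiable times_differentiable_mult
        times_differentiable_affine times_differentiable_flat)
  have nonneg: "\<beta> x \<ge> 0" for x by (auto simp: \<beta>_def flat_def)
  have pos: "\<beta> x > 0" if "0 < x" "x < 1" for x using that by (auto simp: \<beta>_def flat_def)
  have zero: "\<beta> x = 0" if "x \<le> 0 \<or> x \<ge> 1" for x using that by (auto simp: \<beta>_def flat_def)
  have cont: "continuous_on UNIV \<beta>" using smooth_seq_continuous[OF beta_sm, of 0] by simp
  \<comment> \<open>The base point -1 lies strictly to the left of the support of
    \<open>\<beta>\<close>. The fundamental theorem thus covers all \<open>x > -1\<close>, and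
    \<open>F\<close> vanishes on the overlapping half-line \<open>x \<le> 0\<close>, which settles
    the rest.\<close>
  define F where "F x = integral {-1..x} \<beta>" for x
  have dF1: "(F has_real_derivative \<beta> x) (at x)" if "x > -1" for x
  proof -
    have "((\<lambda>u. integral {-1..u} \<beta>) has_real_derivative \<beta> x) (at x within {-1..x+1})"
      by (rule integral_has_real_derivative) (use that cont continuous_on_subset in auto)
    then show ?thesis unfolding F_def
      using that by (simp add: at_within_Icc_at)
  qed
  have F0: "F x = 0" if "x \<le> 0" for x
    unfolding F_def using zero that by (subst integral_cong[where g="\<lambda>_. 0"]) auto
  have dF: "(F has_real_derivative \<beta> x) (at x)" for x
  proof (cases "x > -1")
    case False
    have "((\<lambda>x. 0) has_real_derivative 0) (at x)" by simp
    then have "(F has_real_derivative 0) (at x)"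
      by (rule has_field_derivative_transform_within_open[of _ _ _ "{..<0}"]) (use False in \<open>auto simp: F0\<close>)
    then show ?thesis using False zero by simp
  qed (rule dF1)
  have mono: "F x \<le> F y" if "x \<le> y" for x y
    using that by (rule DERIV_nonneg_imp_nondecreasing) (use dF nonneg in blast)
  have "F 0 < F 1"
    by (rule DERIV_pos_imp_increasing_open[of 0 1 F])
       (use dF pos in \<open>auto intro!: continuous_at_imp_continuous_on DERIV_isCont\<close>)
  then have F1pos: "F 1 > 0" using F0 by simp
  have Fge1: "F x = F 1" if "x \<ge> 1" for x
  proof (cases "x = 1")
    case False
    show ?thesis
    proof (rule DERIV_isconst_end[of 1 x F])
      show "1 < x" using that False by simp
      show "continuous_on {1..x} F"
        using dF by (intro continuous_at_imp_continuous_on ballI DERIV_isCont)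
      show "(F has_real_derivative 0) (at y)" if "1 < y" "y < x" for y
        using dF[of y] zero[of y] that by simp
    qed
  qed simp
  define d where "d k = (case k of 0 \<Rightarrow> (\<lambda>x. F x / F 1) | Suc j \<Rightarrow> (\<lambda>x. (deriv ^^ j) \<beta> x / F 1))" for k
  show ?thesis
  proof (rule that[of d])
    show "smooth_seq d"
      unfolding smooth_seq_def
    proof (intro allI)
      fix k x show "(d k has_real_derivative d (Suc k) x) (at x)"
      proof (cases k)
        case 0
        then show ?thesis using DERIV_cdivide[OF dF[of x], of "F 1"] by (simp add: d_def)
      next
        case (Suc j)
        then show ?thesis
          using DERIV_cdivide[OF smooth_seq_DERIV[OF beta_sm, of j x], of "F 1"] by (simp add: d_def)
      qed
    qed
    show "d 0 x = 0" if "x \<le> 0" for x using that F0 by (simp add: d_def)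
    show "d 0 x = 1" if "x \<ge> 1" for x using Fge1[OF that] F1pos by (simp add: d_def)
    have "0 \<le> F x" "F x \<le> F 1" for x
      using mono[of 0 x] mono[of x 1] F0[of x] F0[of 0] Fge1[of x] F1pos by linarith+
    then show "0 \<le> d 0 x" "d 0 x \<le> 1" for x
      using F1pos by (simp_all add: d_def)
    show "d 1 x \<ge> 0" for x using nonneg F1pos by (simp add: d_def)
  qed
qed

subsection \<open>The fundamental lemma of the calculus of variations\<close>

lemma continuous_bounded_Icc:
  fixes g :: "real \<Rightarrow> real"
  assumes "continuous_on UNIV g"
  obtains M where "M > 0" "\<And>x. x \<in> {a..b} \<Longrightarrow> \<bar>g x\<bar> \<le> M"
proof -
  have "compact (g ` {a..b})"
    by (rule compact_continuous_image[OF continuous_on_subset[OF assms] compact_Icc]) simp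
  then obtain M where M: "\<forall>y \<in> g ` {a..b}. \<bar>y\<bar> \<le> M"
    using compact_imp_bounded by (force simp: bounded_iff)
  then have "\<bar>g x\<bar> \<le> max M 1" if "x \<in> {a..b}" for x
    using that by (auto simp: le_max_iff_disj)
  then show ?thesis using that[of "max M 1"] by simp
qed

lemma integrable_continuous_vanishing:
  fixes g :: "real \<Rightarrow> real"
  assumes "continuous_on UNIV g" "\<And>x. x \<notin> {a..b} \<Longrightarrow> g x = 0"
  shows "integrable lborel g"
proof -
  have "set_integrable lborel {a..b} g"
    by (rule borel_integrable_atLeastAtMost'[OF continuous_on_subset[OF assms(1)]]) simp
  moreover have "(\<lambda>x. indicator {a..b} x *\<^sub>R g x) = g"
    using assms(2) by (fastforce simp: fun_eq_iff indicator_def)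
  ultimately show ?thesis by (simp add: set_integrable_def)
qed

text \<open>The difference of two steps, one at \<open>a\<close> and one at \<open>b\<close>,
  steepened by the factor \<open>n + 1\<close>. A step is 0 at its own starting point, hence the
  half-open interval in the limit. Its derivative is an approximate identity at that point, which
  produces \<open>g a - g b\<close>.\<close>

lemma smooth_plateau:
  fixes a b :: real
  assumes "a < b"
  obtains \<rho> :: "nat \<Rightarrow> nat \<Rightarrow> real \<Rightarrow> real" where
    "\<And>n. smooth_seq (\<rho> n)" "\<And>n x. x \<notin> {a..b + 1} \<Longrightarrow> \<rho> n 0 x = 0" "\<And>n x. \<bar>\<rho> n 0 x\<bar> \<le> 1"
    "\<And>x. (\<lambda>n. \<rho> n 0 x) \<longlonglongrightarrow> indicator {a<..b} x"
    "\<And>g. continuous_on UNIV g \<Longrightarrow> (\<lambda>n. LINT x|lborel. \<rho> n 1 x * g x) \<longlonglongrightarrow> g a - g b"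
proof -
  obtain d where d: "smooth_seq d" and d0: "\<And>x. x \<le> 0 \<Longrightarrow> d 0 x = 0" and d1: "\<And>x. x \<ge> 1 \<Longrightarrow> d 0 x = 1"
    and dnn: "\<And>x. 0 \<le> d 0 x" and dle: "\<And>x. d 0 x \<le> 1" and dpos: "\<And>x. d 1 x \<ge> 0"
    by (rule smooth_step, rule that)
  have dz: "d 1 x = 0" if "x \<notin> {0..1}" for x
  proof (cases "x < 0")
    case True
    show ?thesis
      by (rule DERIV_eq_0_if_vanishing[of "d 0" _ x "{..<0}"])
         (use True smooth_seq_DERIV[OF d, of 0 x] d0 in auto)
  next
    case False
    show ?thesis
      by (rule DERIV_eq_0_if_vanishing[of "\<lambda>x. d 0 x - 1" _ x "{1<..}"])
         (use False that smooth_seq_DERIV[OF d, of 0 x] d1 in \<open>auto intro!: derivative_eq_intros\<close>)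
  qed
  have dcont: "continuous_on A (d k)" for k A
    using smooth_seq_continuous[OF d] continuous_on_subset by blast
  have dint: "integrable lborel (d 1)"
    by (rule integrable_continuous_vanishing[OF dcont dz])
  have d_int1: "(LINT x|lborel. d 1 x) = 1"
  proof -
    have "(LINT x|lborel. d 1 x) = (LINT x|lborel. d 1 x * indicator {0..1} x)"
      using dz by (intro Bochner_Integration.integral_cong) (auto simp: indicator_def)
    also have "\<dots> = d 0 1 - d 0 0"
      by (rule integral_FTC_Icc_real)
         (use smooth_seq_DERIV[OF d, of 0] dcont[of UNIV 1] in
           \<open>auto simp: continuous_on_eq_continuous_at\<close>)
    finally show ?thesis using d0[of 0] d1[of 1] by simp
  qed
  \<comment> \<open>The shift from \<open>n\<close> to \<open>Suc n\<close> gives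
    \<open>c n \<ge> 1\<close>, so every transition takes place inside \<open>{p..p + 1}\<close>;
    this is the origin of \<open>b + 1\<close> in the support.\<close>
  define c where "c n = real (Suc n)" for n
  have cpos: "c n \<ge> 1" for n by (simp add: c_def)
  define \<kappa> where "\<kappa> p n k x = c n ^ k * d k (- (c n * p) + c n * x)" for p n k x
  have \<kappa>sm: "smooth_seq (\<kappa> p n)" for p n
    unfolding \<kappa>_def by (rule smooth_seq_affine[OF d])
  have conv0: "(\<lambda>n. \<kappa> p n 0 x) \<longlonglongrightarrow> indicator {p<..} x" for p x
  proof (cases "x \<le> p")
    case True
    have "\<kappa> p n 0 x = 0" for n
      using True cpos[of n] mult_left_mono[OF True, of "c n"] by (auto simp: \<kappa>_def intro!: d0)
    then show ?thesis using True by simp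
  next
    case False
    obtain N where N: "1 / (x - p) < real N" using reals_Archimedean2 by blast
    have "\<kappa> p n 0 x = 1" if "n \<ge> N" for n
    proof -
      have "1 / (x - p) \<le> c n" using N that by (simp add: c_def)
      then have "1 \<le> c n * (x - p)" using False by (simp add: field_simps)
      then show ?thesis by (auto simp: \<kappa>_def algebra_simps intro!: d1)
    qed
    then have "(\<lambda>n. \<kappa> p n 0 x) \<longlonglongrightarrow> 1"
      by (intro tendsto_eventually) (auto simp: eventually_sequentially)
    then show ?thesis using False by simp
  qed
  have conv1: "(\<lambda>n. LINT x|lborel. \<kappa> p n 1 x * g x) \<longlonglongrightarrow> g p"
    and intk: "integrable lborel (\<lambda>x. \<kappa> p n 1 x * g x)" if g: "continuous_on UNIV g" for p g n
  proof -
    have gm: "g \<in> borel_measurable borel" using g by (rule borel_measurable_continuous_onI)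
    have dm[measurable]: "d k \<in> borel_measurable borel" for k using d by (rule smooth_seq_measurable)
    \<comment> \<open>The substitution \<open>x = p + y / c n\<close> absorbs the factor
      \<open>c n\<close> contained in the derivative of the rescaled step.\<close>
    have eq: "(LINT x|lborel. \<kappa> p n 1 x * g x) = (LINT y|lborel. d 1 y * g (p + y / c n))" for n
      using cpos[of n]
      by (subst lborel_integral_real_affine[of "1 / c n" _ p])
         (auto simp: \<kappa>_def algebra_simps simp flip: integral_mult_right_zero)
    obtain M where M: "M > 0" "\<And>x. x \<in> {p..p+1} \<Longrightarrow> \<bar>g x\<bar> \<le> M"
      using continuous_bounded_Icc[OF g, of p "p+1"] by metis
    have "(\<lambda>n. LINT y|lborel. d 1 y * g (p + y / c n)) \<longlonglongrightarrow> (LINT y|lborel. d 1 y * g p)"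
    proof (rule integral_dominated_convergence[where w="\<lambda>y. M * d 1 y"])
      show "integrable lborel (\<lambda>y. M * d 1 y)" using dint by simp
      show "AE y in lborel. (\<lambda>n. d 1 y * g (p + y / c n)) \<longlonglongrightarrow> d 1 y * g p"
      proof (rule AE_I2)
        fix y :: real
        have "(\<lambda>n. p + y / c n) \<longlonglongrightarrow> p" unfolding c_def by real_asymp
        moreover have "isCont g p" using g by (simp add: continuous_on_eq_continuous_at)
        ultimately have "(\<lambda>n. g (p + y / c n)) \<longlonglongrightarrow> g p" by (rule isCont_tendsto_compose[rotated])
        then show "(\<lambda>n. d 1 y * g (p + y / c n)) \<longlonglongrightarrow> d 1 y * g p" by (rule tendsto_mult_left)
      qed
      show "AE y in lborel. norm (d 1 y * g (p + y / c n)) \<le> M * d 1 y" for n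
      proof (rule AE_I2)
        fix y :: real
        show "norm (d 1 y * g (p + y / c n)) \<le> M * d 1 y"
        proof (cases "y \<in> {0..1}")
          case True
          then have "y / c n \<in> {0..1}" using cpos[of n] by (auto simp: field_simps)
          then have "\<bar>g (p + y / c n)\<bar> \<le> M" using M(2) by auto
          from mult_right_mono[OF this dpos[of y]] show ?thesis
            using dpos[of y] by (simp add: abs_mult mult.commute)
        next
          case False
          then show ?thesis using dz[OF False] by simp
        qed
      qed
    qed (use gm in measurable)
    then show "(\<lambda>n. LINT x|lborel. \<kappa> p n 1 x * g x) \<longlonglongrightarrow> g p"
      unfolding eq using d_int1 by simp
    show "integrable lborel (\<lambda>x. \<kappa> p n 1 x * g x)"
    proof (rule integrable_continuous_vanishing[where a="p" and b="p + 1"])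
      show "continuous_on UNIV (\<lambda>x. \<kappa> p n 1 x * g x)"
        by (intro continuous_on_mult g smooth_seq_continuous[OF \<kappa>sm])
      fix x assume x: "x \<notin> {p..p+1}"
      have "c n * (x - p) \<notin> {0..1}"
      proof
        assume *: "c n * (x - p) \<in> {0..1}"
        then have "x - p \<ge> 0" using cpos[of n] by (auto simp: zero_le_mult_iff)
        moreover from this have "x - p \<le> c n * (x - p)" using cpos[of n]
          by (simp add: mult_le_cancel_right1)
        ultimately show False using x * by auto
      qed
      then have "- (c n * p) + c n * x \<notin> {0..1}" by (simp add: algebra_simps)
      from dz[OF this] show "\<kappa> p n 1 x * g x = 0" by (simp add: \<kappa>_def)
    qed
  qed
  show ?thesis
  proof (rule that[of "\<lambda>n k x. \<kappa> a n k x - \<kappa> b n k x"])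
    show "smooth_seq (\<lambda>k x. \<kappa> a n k x - \<kappa> b n k x)" for n
      by (intro smooth_seq_diff \<kappa>sm)
    show "\<bar>\<kappa> a n 0 x - \<kappa> b n 0 x\<bar> \<le> 1" for n x
    proof -
      have "0 \<le> \<kappa> p n 0 x \<and> \<kappa> p n 0 x \<le> 1" for p by (simp add: \<kappa>_def dnn dle)
      from this[of a] this[of b] show ?thesis by linarith
    qed
    show "(\<lambda>n. \<kappa> a n 0 x - \<kappa> b n 0 x) \<longlonglongrightarrow> indicator {a<..b} x" for x
    proof -
      have "indicator {a<..b} x = (indicator {a<..} x - indicator {b<..} x :: real)"
        using assms by (auto simp: indicator_def)
      then show ?thesis using tendsto_diff[OF conv0[of a x] conv0[of b x]] by simp
    qed
    show "\<kappa> a n 0 x - \<kappa> b n 0 x = 0" if "x \<notin> {a..b+1}" for n x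
    proof (cases "x < a")
      case True
      have "c n * x \<le> c n * a" "c n * x \<le> c n * b" using True assms cpos[of n] by auto
      then show ?thesis by (simp add: \<kappa>_def d0)
    next
      case False
      have *: "1 \<le> c n * (x - p)" if "p \<le> b" for p
        using mult_mono[of 1 "c n" 1 "x - p"] cpos[of n] that False \<open>x \<notin> {a..b+1}\<close> by auto
      have "1 \<le> - (c n * a) + c n * x" "1 \<le> - (c n * b) + c n * x"
        using *[of a] *[of b] assms by (simp_all add: algebra_simps)
      then show ?thesis by (simp add: \<kappa>_def d1)
    qed
    show "(\<lambda>n. LINT x|lborel. (\<kappa> a n 1 x - \<kappa> b n 1 x) * g x) \<longlonglongrightarrow> g a - g b"
      if "continuous_on UNIV g" for g
      using tendsto_diff[OF conv1[OF that, of a] conv1[OF that, of b]] intk[OF that]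
      by (simp add: left_diff_distrib)
  qed
qed

text \<open>Testing with plateaus on \<open>{p..q}\<close> turns the weak identity into
  \<open>g q - g p = integral {p..q} R\<close>; continuity of \<open>R\<close> then makes the weak
  derivative a classical one.\<close>

lemma DERIV_if_weak_deriv:
  fixes g R :: "real \<Rightarrow> real"
  assumes g: "continuous_on UNIV g" and R: "continuous_on UNIV R" and "t > 0"
    and weak: "\<And>d a L. smooth_seq d \<Longrightarrow> a > 0 \<Longrightarrow> (\<And>x. x \<notin> {a..L} \<Longrightarrow> d 0 x = 0) \<Longrightarrow>
                 (LINT t|lborel. d 1 t * g t) + (LINT t|lborel. d 0 t * R t) = 0"
  shows "(g has_real_derivative R t) (at t)"
proof -
  have Rm[measurable]: "R \<in> borel_measurable borel" using R by (rule borel_measurable_continuous_onI)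
  have eq: "g q - g p = integral {p..q} R" if pq: "0 < p" "p < q" for p q
  proof -
    obtain \<rho> :: "nat \<Rightarrow> nat \<Rightarrow> real \<Rightarrow> real" where
      sm: "\<And>n. smooth_seq (\<rho> n)" and van: "\<And>n x. x \<notin> {p..q + 1} \<Longrightarrow> \<rho> n 0 x = 0"
      and le1: "\<And>n x. \<bar>\<rho> n 0 x\<bar> \<le> 1"
      and conv: "\<And>x. (\<lambda>n. \<rho> n 0 x) \<longlonglongrightarrow> indicator {p<..q} x"
      and conv1: "\<And>g. continuous_on UNIV g \<Longrightarrow> (\<lambda>n. LINT x|lborel. \<rho> n 1 x * g x) \<longlonglongrightarrow> g p - g q"
      by (rule smooth_plateau[OF pq(2)], rule that)
    have [measurable]: "\<rho> n k \<in> borel_measurable borel" for n k using sm by (rule smooth_seq_measurable)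
    obtain M where M: "M > 0" "\<And>x. x \<in> {p..q+1} \<Longrightarrow> \<bar>R x\<bar> \<le> M"
      using continuous_bounded_Icc[OF R, of p "q+1"] by metis
    have "(\<lambda>n. LINT x|lborel. \<rho> n 0 x * R x) \<longlonglongrightarrow> (LINT x|lborel. indicator {p<..q} x * R x)"
    proof (rule integral_dominated_convergence[where w="\<lambda>x. M * indicator {p..q+1} x"])
      show "integrable lborel (\<lambda>x. M * indicator {p..q + 1} x)" using pq by simp
      show "AE x in lborel. (\<lambda>n. \<rho> n 0 x * R x) \<longlonglongrightarrow> indicator {p<..q} x * R x"
        using conv by (auto intro!: tendsto_mult_right)
      show "AE x in lborel. norm (\<rho> n 0 x * R x) \<le> M * indicator {p..q+1} x" for n
      proof (rule AE_I2)
        fix x show "norm (\<rho> n 0 x * R x) \<le> M * indicator {p..q+1} x"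
          using van[of x n] le1[of n x] M(2)[of x] mult_mono[of "\<bar>\<rho> n 0 x\<bar>" 1 "\<bar>R x\<bar>" M]
          by (cases "x \<in> {p..q+1}") (auto simp: abs_mult)
      qed
    qed measurable
    moreover have "(LINT x|lborel. \<rho> n 1 x * g x) + (LINT x|lborel. \<rho> n 0 x * R x) = 0" for n
      by (rule weak[OF sm pq(1)]) (rule van)
    then have "(LINT x|lborel. \<rho> n 0 x * R x) = - (LINT x|lborel. \<rho> n 1 x * g x)" for n
      by (simp add: eq_neg_iff_add_eq_0 add.commute)
    ultimately have "(LINT x|lborel. indicator {p<..q} x * R x) = - (g p - g q)"
      using tendsto_minus[OF conv1[OF g]] LIMSEQ_unique by force
    moreover have "(LINT x|lborel. indicator {p<..q} x * R x) = (LINT x|lborel. indicator {p..q} x * R x)"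
      using AE_lborel_singleton[of p]
      by (intro integral_cong_AE) (auto elim!: eventually_mono simp: indicator_def)
    moreover have "(LINT x|lborel. indicator {p..q} x * R x) = integral {p..q} R"
      using set_borel_integral_eq_integral(2)[OF borel_integrable_atLeastAtMost'[OF continuous_on_subset[OF R]]]
      by (auto simp: set_lebesgue_integral_def)
    ultimately show ?thesis by simp
  qed
  \<comment> \<open>A base point strictly between 0 and \<open>t\<close> keeps the supports of all
    plateaus in the open half-line where \<open>weak\<close> applies.\<close>
  define p where "p = t / 2"
  have p: "0 < p" "p < t" using \<open>t > 0\<close> by (auto simp: p_def)
  have "((\<lambda>u. integral {p..u} R) has_real_derivative R t) (at t within {p..t+1})"
    by (rule integral_has_real_derivative) (use p R continuous_on_subset in auto)
  then have "((\<lambda>u. integral {p..u} R) has_real_derivative R t) (at t)"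
    using p by (simp add: at_within_Icc_at)
  then have "((\<lambda>u. g p + integral {p..u} R) has_real_derivative R t) (at t)"
    by (auto intro!: derivative_eq_intros)
  then show ?thesis
    by (rule has_field_derivative_transform_within_open[of _ _ _ "{p<..}"])
       (use p eq[of p] in \<open>auto simp: algebra_simps\<close>)
qed

text \<open>Plateaus show that the integral of \<open>g\<close> over every bounded interval
  vanishes. Complements and countable disjoint unions extend this to all Borel sets, and a density
  with zero integrals vanishes a.e. Since \<open>g\<close> is only locally integrable, this is done
  on \<open>{-N..N}\<close> for each natural \<open>N\<close>.\<close>

lemma AE_eq_0_if_orthogonal_to_tests:
  fixes g :: "real \<Rightarrow> real"
  assumes gm[measurable]: "g \<in> borel_measurable borel"
    and gi: "\<And>L. integrable lborel (\<lambda>x. g x * indicator {-L..L} x)"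
    and orth: "\<And>d. test_seq d \<Longrightarrow> (LINT x|lborel. g x * d 0 x) = 0"
  shows "AE x in lborel. g x = 0"
proof -
  have gi': "integrable lborel (\<lambda>x. g x * indicator {a..b} x)" for a b
    by (rule Bochner_Integration.integrable_bound[OF gi[of "max \<bar>a\<bar> \<bar>b\<bar>"]])
       (auto simp: indicator_def)
  have Ioc: "(LINT x|lborel. g x * indicator {a<..b} x) = 0" if ab: "a < b" for a b
  proof -
    obtain \<rho> :: "nat \<Rightarrow> nat \<Rightarrow> real \<Rightarrow> real" where
      sm: "\<And>n. smooth_seq (\<rho> n)" and van: "\<And>n x. x \<notin> {a..b + 1} \<Longrightarrow> \<rho> n 0 x = 0"
      and le1: "\<And>n x. \<bar>\<rho> n 0 x\<bar> \<le> 1"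
      and conv: "\<And>x. (\<lambda>n. \<rho> n 0 x) \<longlonglongrightarrow> indicator {a<..b} x"
      and conv1: "\<And>g. continuous_on UNIV g \<Longrightarrow> (\<lambda>n. LINT x|lborel. \<rho> n 1 x * g x) \<longlonglongrightarrow> g a - g b"
      by (rule smooth_plateau[OF ab], rule that)
    have [measurable]: "\<rho> n k \<in> borel_measurable borel" for n k using sm by (rule smooth_seq_measurable)
    have "test_seq (\<rho> n)" for n
      by (rule test_seqI[OF sm, of "max \<bar>a\<bar> \<bar>b+1\<bar>"]) (auto intro!: van)
    then have z: "(LINT x|lborel. g x * \<rho> n 0 x) = 0" for n using orth by blast
    have "(\<lambda>n. LINT x|lborel. g x * \<rho> n 0 x) \<longlonglongrightarrow> (LINT x|lborel. g x * indicator {a<..b} x)"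
    proof (rule integral_dominated_convergence[where w="\<lambda>x. \<bar>g x * indicator {a..b+1} x\<bar>"])
      show "integrable lborel (\<lambda>x. \<bar>g x * indicator {a..b+1} x\<bar>)"
        using gi' by (rule integrable_abs)
      show "AE x in lborel. (\<lambda>n. g x * \<rho> n 0 x) \<longlonglongrightarrow> g x * indicator {a<..b} x"
        using conv by (auto intro!: tendsto_mult_left)
      show "AE x in lborel. norm (g x * \<rho> n 0 x) \<le> \<bar>g x * indicator {a..b+1} x\<bar>" for n
      proof (rule AE_I2)
        fix x show "norm (g x * \<rho> n 0 x) \<le> \<bar>g x * indicator {a..b+1} x\<bar>"
          using van[of x n] le1[of n x] mult_left_mono[of "\<bar>\<rho> n 0 x\<bar>" 1 "\<bar>g x\<bar>"]
          by (cases "x \<in> {a..b+1}") (auto simp: abs_mult)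
      qed
    qed measurable
    then show ?thesis by (simp only: z) (simp add: LIMSEQ_const_iff)
  qed
  have Icc: "(LINT x|lborel. g x * indicator {a..b} x) = 0" for a b
  proof (cases "a < b")
    case True
    have "(LINT x|lborel. g x * indicator {a..b} x) = (LINT x|lborel. g x * indicator {a<..b} x)"
      using AE_lborel_singleton[of a]
      by (intro integral_cong_AE) (auto elim!: eventually_mono simp: indicator_def)
    then show ?thesis using Ioc[OF True] by simp
  next
    case False
    have "AE x in lborel. g x * indicator {a..b} x = 0"
      using AE_lborel_singleton[of a] by eventually_elim (use False in \<open>auto simp: indicator_def\<close>)
    then show ?thesis by (rule integral_eq_zero_AE)
  qed
  have "AE x in lborel. g x * indicator {-real N..real N} x = 0" for N :: nat
  proof (rule density_unique_real[OF gi])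
    define f where "f x = g x * indicator {-real N..real N} x" for x
    have fi: "integrable lborel f" unfolding f_def by (rule gi)
    have sf: "set_integrable lborel A f" if "A \<in> sets borel" for A
      unfolding set_integrable_def using fi that by (intro integrable_mult_indicator) auto
    fix A :: "real set" assume "A \<in> sets lborel"
    then have "A \<in> sets borel" by simp
    then have "(LINT x:A|lborel. f x) = 0"
    proof (induction rule: borel_set_induct)
      case empty
      then show ?case by (simp add: set_lebesgue_integral_def)
    next
      case (interval a b)
      have "(LINT x:{a..b}|lborel. f x) = (LINT x|lborel. g x * indicator {max a (-real N)..min b (real N)} x)"
        unfolding set_lebesgue_integral_def f_def
        by (intro Bochner_Integration.integral_cong) (auto simp: indicator_def)
      then show ?case using Icc by simp
    next
      case (compl A)
      have "(LINT x|lborel. f x) = (LINT x:A|lborel. f x) + (LINT x:-A|lborel. f x)"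
        using set_integral_Un[of A "-A" lborel f] sf compl
        by (simp add: set_lebesgue_integral_def)
      moreover have "(LINT x|lborel. f x) = 0" unfolding f_def using Icc by simp
      ultimately show ?case using compl by simp
    next
      case (union F)
      have "(LINT x:(\<Union>i. F i)|lborel. f x) = (\<Sum>i. (LINT x:(F i)|lborel. f x))"
        using union by (intro lebesgue_integral_countable_add sf) (auto simp: disjoint_family_on_def)
      then show ?case using union by simp
    qed
    then show "(LINT x:A|lborel. g x * indicator {-real N..real N} x) = (LINT x:A|lborel. 0)"
      by (simp add: f_def)
  qed simp
  then have "AE x in lborel. \<forall>N::nat. g x * indicator {-real N..real N} x = 0"
    by (subst AE_all_countable) blast
  then show ?thesis
  proof eventually_elim
    case (elim x)
    obtain N :: nat where "\<bar>x\<bar> \<le> N" using real_arch_simple by blast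
    then show ?case using elim[rule_format, of N] by (auto simp: indicator_def abs_le_iff split: if_splits)
  qed
qed

subsection \<open>Curves in $L^2$ and $L^1$\<close>

lemma tendsto_0_if_le:
  fixes f B :: "real \<Rightarrow> real"
  assumes "(B \<longlongrightarrow> 0) (at t within S)" "\<And>s. s \<in> S \<Longrightarrow> 0 \<le> f s" "\<And>s. s \<in> S \<Longrightarrow> f s \<le> B s"
  shows "(f \<longlongrightarrow> 0) (at t within S)"
proof (rule tendsto_sandwich[OF _ _ tendsto_const assms(1)])
  show "\<forall>\<^sub>F s in at t within S. 0 \<le> f s"
    unfolding eventually_at_filter by (intro always_eventually) (use assms(2) in blast)
  show "\<forall>\<^sub>F s in at t within S. f s \<le> B s"
    unfolding eventually_at_filter by (intro always_eventually) (use assms(3) in blast)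
qed

lemma L2_mult_integrable:
  assumes "L2 f" "L2 g" shows "integrable lborel (\<lambda>x. f x * g x)"
proof (rule Bochner_Integration.integrable_bound)
  show "integrable lborel (\<lambda>x. (f x)\<^sup>2 + (g x)\<^sup>2)"
    using assms by (simp add: L2_def)
  show "(\<lambda>x. f x * g x) \<in> borel_measurable lborel"
    using assms by (auto simp: L2_def)
  show "AE x in lborel. norm (f x * g x) \<le> norm ((f x)\<^sup>2 + (g x)\<^sup>2)"
  proof (rule AE_I2)
    fix x
    have "2 * \<bar>f x\<bar> * \<bar>g x\<bar> \<le> \<bar>f x\<bar>\<^sup>2 + \<bar>g x\<bar>\<^sup>2" by (rule sum_squares_bound)
    moreover have "0 \<le> \<bar>f x\<bar> * \<bar>g x\<bar>" by simp
    ultimately have "\<bar>f x\<bar> * \<bar>g x\<bar> \<le> \<bar>f x\<bar>\<^sup>2 + \<bar>g x\<bar>\<^sup>2" by linarith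
    then show "norm (f x * g x) \<le> norm ((f x)\<^sup>2 + (g x)\<^sup>2)"
      by (simp add: abs_mult)
  qed
qed

lemma L2_cmult: "L2 f \<Longrightarrow> L2 (\<lambda>x. c * f x)"
  by (auto simp: L2_def power_mult_distrib)

lemma L2_add: assumes "L2 f" "L2 g" shows "L2 (\<lambda>x. f x + g x)"
  using assms L2_mult_integrable[OF assms]
  by (auto simp: L2_def power2_sum mult.assoc)

lemma L2_diff: assumes "L2 f" "L2 g" shows "L2 (\<lambda>x. f x - g x)"
  using L2_add[OF assms(1) L2_cmult[OF assms(2), of "-1"]] by simp

lemma L2_abs: "L2 f \<Longrightarrow> L2 (\<lambda>x. \<bar>f x\<bar>)"
  by (auto simp: L2_def)

lemma L2_affine: "L2 f \<Longrightarrow> c \<noteq> 0 \<Longrightarrow> L2 (\<lambda>x. f (a + c * x))"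
  using lborel_integrable_real_affine[of "\<lambda>x. (f x)\<^sup>2" c a] by (auto simp: L2_def)

lemma L2_Cauchy_Schwarz:
  assumes "L2 f" "L2 g"
  shows "(LINT x|lborel. \<bar>f x * g x\<bar>) \<le> sqrt (LINT x|lborel. (f x)\<^sup>2) * sqrt (LINT x|lborel. (g x)\<^sup>2)"
proof -
  have [measurable]: "f \<in> borel_measurable borel" "g \<in> borel_measurable borel"
    using assms by (auto simp: L2_def)
  have "(\<integral>\<^sup>+x. ennreal \<bar>f x\<bar> * ennreal \<bar>g x\<bar> \<partial>lborel)\<^sup>2
      \<le> (\<integral>\<^sup>+x. (ennreal \<bar>f x\<bar>)\<^sup>2 \<partial>lborel) * (\<integral>\<^sup>+x. (ennreal \<bar>g x\<bar>)\<^sup>2 \<partial>lborel)"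
    by (rule Cauchy_Schwarz_nn_integral) auto
  moreover have "(\<integral>\<^sup>+x. ennreal \<bar>f x\<bar> * ennreal \<bar>g x\<bar> \<partial>lborel) = ennreal (LINT x|lborel. \<bar>f x * g x\<bar>)"
    using integrable_abs[OF L2_mult_integrable[OF assms]]
    by (subst nn_integral_eq_integral[symmetric]) (auto simp: abs_mult ennreal_mult)
  moreover have "(\<integral>\<^sup>+x. (ennreal \<bar>h x\<bar>)\<^sup>2 \<partial>lborel) = ennreal (LINT x|lborel. (h x)\<^sup>2)" if "L2 h" for h
    using that
    by (subst nn_integral_eq_integral[symmetric]) (auto simp: L2_def ennreal_power)
  ultimately have "ennreal ((LINT x|lborel. \<bar>f x * g x\<bar>)\<^sup>2)
      \<le> ennreal ((LINT x|lborel. (f x)\<^sup>2) * (LINT x|lborel. (g x)\<^sup>2))"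
    using assms by (simp add: ennreal_power ennreal_mult)
  then have "(LINT x|lborel. \<bar>f x * g x\<bar>)\<^sup>2 \<le> (LINT x|lborel. (f x)\<^sup>2) * (LINT x|lborel. (g x)\<^sup>2)"
    by (subst (asm) ennreal_le_iff) auto
  from real_sqrt_le_mono[OF this] show ?thesis by (simp add: real_sqrt_mult)
qed

definition L2_curve :: "(real \<Rightarrow> real \<Rightarrow> real) \<Rightarrow> bool" where
  "L2_curve a \<longleftrightarrow> (\<forall>t\<ge>0. L2 (a t)) \<and>
     (\<forall>t\<ge>0. ((\<lambda>s. LINT x|lborel. (a s x - a t x)\<^sup>2) \<longlongrightarrow> 0) (at t within {0..}))"

definition L1_curve :: "(real \<Rightarrow> real \<Rightarrow> real) \<Rightarrow> bool" where
  "L1_curve F \<longleftrightarrow> (\<forall>t\<ge>0. integrable lborel (F t)) \<and>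
     (\<forall>t\<ge>0. ((\<lambda>s. LINT x|lborel. \<bar>F s x - F t x\<bar>) \<longlongrightarrow> 0) (at t within {0..}))"

text \<open>Each of the two nonnegative summands is bounded by their sum, so continuity into H1
  splits into two continuities into L2. All nonlinear terms of the equation are then sums of
  products of L2 curves.\<close>

lemma CH1_iff:
  "CH1 u ux \<longleftrightarrow> L2_curve u \<and> L2_curve ux \<and> (\<forall>t\<ge>0. weak_deriv (u t) (ux t))"
proof
  assume *: "CH1 u ux"
  have "((\<lambda>s. LINT x|lborel. (u s x - u t x)\<^sup>2) \<longlongrightarrow> 0) (at t within {0..})"
    "((\<lambda>s. LINT x|lborel. (ux s x - ux t x)\<^sup>2) \<longlongrightarrow> 0) (at t within {0..})" if "t \<ge> 0" for t
  proof -
    have lim: "((\<lambda>s. (LINT x|lborel. (u s x - u t x)\<^sup>2) + (LINT x|lborel. (ux s x - ux t x)\<^sup>2))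
              \<longlongrightarrow> 0) (at t within {0..})" using * that by (simp add: CH1_def)
    show "((\<lambda>s. LINT x|lborel. (u s x - u t x)\<^sup>2) \<longlongrightarrow> 0) (at t within {0..})"
      by (rule tendsto_sandwich[OF _ _ tendsto_const lim]) auto
    show "((\<lambda>s. LINT x|lborel. (ux s x - ux t x)\<^sup>2) \<longlongrightarrow> 0) (at t within {0..})"
      by (rule tendsto_sandwich[OF _ _ tendsto_const lim]) auto
  qed
  then show "L2_curve u \<and> L2_curve ux \<and> (\<forall>t\<ge>0. weak_deriv (u t) (ux t))"
    using * by (auto simp: CH1_def L2_curve_def H1_def)
next
  assume *: "L2_curve u \<and> L2_curve ux \<and> (\<forall>t\<ge>0. weak_deriv (u t) (ux t))"
  then have "((\<lambda>s. (LINT x|lborel. (u s x - u t x)\<^sup>2) + (LINT x|lborel. (ux s x - ux t x)\<^sup>2))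
              \<longlongrightarrow> 0 + 0) (at t within {0..})" if "t \<ge> 0" for t
    using that by (intro tendsto_add) (auto simp: L2_curve_def)
  then show "CH1 u ux" using * by (auto simp: CH1_def L2_curve_def H1_def)
qed

lemma L2_curve_const: "L2 f \<Longrightarrow> L2_curve (\<lambda>t. f)"
  by (simp add: L2_curve_def)

text \<open>The increment of the product is expanded into increments plus values at the fixed time
  \<open>t\<close>, and Cauchy-Schwarz bounds each piece. No norm at the varying time
  \<open>s\<close> remains, so no local bound on the norms is required.\<close>

lemma L1_curve_mult:
  assumes "L2_curve a" "L2_curve b" shows "L1_curve (\<lambda>t x. a t x * b t x)"
  unfolding L1_curve_def
proof (intro conjI allI impI)
  fix t :: real assume t: "t \<ge> 0"
  then show "integrable lborel (\<lambda>x. a t x * b t x)"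
    using assms by (intro L2_mult_integrable) (auto simp: L2_curve_def)
  define N where "N f = sqrt (LINT x|lborel. (f x)\<^sup>2)" for f :: "real \<Rightarrow> real"
  have la: "((\<lambda>s. N (\<lambda>x. a s x - a t x)) \<longlongrightarrow> 0) (at t within {0..})"
    using tendsto_real_sqrt[of "\<lambda>s. LINT x|lborel. (a s x - a t x)\<^sup>2" 0] assms(1) t
    unfolding N_def L2_curve_def by simp
  have lb: "((\<lambda>s. N (\<lambda>x. b s x - b t x)) \<longlongrightarrow> 0) (at t within {0..})"
    using tendsto_real_sqrt[of "\<lambda>s. LINT x|lborel. (b s x - b t x)\<^sup>2" 0] assms(2) t
    unfolding N_def L2_curve_def by simp
  show "((\<lambda>s. LINT x|lborel. \<bar>a s x * b s x - a t x * b t x\<bar>) \<longlongrightarrow> 0) (at t within {0..})"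
  proof (rule tendsto_0_if_le)
    let ?B = "\<lambda>s. N (\<lambda>x. a s x - a t x) * N (\<lambda>x. b s x - b t x) + N (a t) * N (\<lambda>x. b s x - b t x)
                + N (\<lambda>x. a s x - a t x) * N (b t)"
    have "(?B \<longlongrightarrow> 0 * 0 + N (a t) * 0 + 0 * N (b t)) (at t within {0..})"
      by (intro tendsto_intros la lb)
    then show "(?B \<longlongrightarrow> 0) (at t within {0..})" by simp
    show "(LINT x|lborel. \<bar>a s x * b s x - a t x * b t x\<bar>) \<le> ?B s" if "s \<in> {0..}" for s
    proof -
      from that have L: "L2 (a s)" "L2 (a t)" "L2 (b s)" "L2 (b t)" using assms t by (auto simp: L2_curve_def)
      note Ld = L2_diff[OF L(1,2)] L2_diff[OF L(3,4)]
      have i: "integrable lborel (\<lambda>x. \<bar>(a s x - a t x) * (b s x - b t x)\<bar>)"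
        "integrable lborel (\<lambda>x. \<bar>a t x * (b s x - b t x)\<bar>)"
        "integrable lborel (\<lambda>x. \<bar>(a s x - a t x) * b t x\<bar>)"
        using Ld L by (auto intro!: integrable_abs L2_mult_integrable)
      have "(LINT x|lborel. \<bar>a s x * b s x - a t x * b t x\<bar>)
         \<le> (LINT x|lborel. \<bar>(a s x - a t x) * (b s x - b t x)\<bar> + \<bar>a t x * (b s x - b t x)\<bar>
              + \<bar>(a s x - a t x) * b t x\<bar>)"
      proof (rule integral_mono)
        show "integrable lborel (\<lambda>x. \<bar>a s x * b s x - a t x * b t x\<bar>)"
          using L by (intro integrable_abs Bochner_Integration.integrable_diff L2_mult_integrable)
        show "integrable lborel (\<lambda>x. \<bar>(a s x - a t x) * (b s x - b t x)\<bar>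
            + \<bar>a t x * (b s x - b t x)\<bar> + \<bar>(a s x - a t x) * b t x\<bar>)"
          using i by (intro Bochner_Integration.integrable_add)
        fix x
        have "a s x * b s x - a t x * b t x = (a s x - a t x) * (b s x - b t x)
            + a t x * (b s x - b t x) + (a s x - a t x) * b t x" by (simp add: algebra_simps)
        then show "\<bar>a s x * b s x - a t x * b t x\<bar> \<le> \<bar>(a s x - a t x) * (b s x - b t x)\<bar>
            + \<bar>a t x * (b s x - b t x)\<bar> + \<bar>(a s x - a t x) * b t x\<bar>" by linarith
      qed
      also have "\<dots> = (LINT x|lborel. \<bar>(a s x - a t x) * (b s x - b t x)\<bar>)
          + (LINT x|lborel. \<bar>a t x * (b s x - b t x)\<bar>) + (LINT x|lborel. \<bar>(a s x - a t x) * b t x\<bar>)"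
        using i by simp
      also have "\<dots> \<le> ?B s"
        unfolding N_def by (intro add_mono L2_Cauchy_Schwarz Ld L)
      finally show "(LINT x|lborel. \<bar>a s x * b s x - a t x * b t x\<bar>) \<le> ?B s" .
    qed
  qed auto
qed

lemma L1_curve_add:
  assumes "L1_curve F" "L1_curve G" shows "L1_curve (\<lambda>t x. F t x + G t x)"
  unfolding L1_curve_def
proof (intro conjI allI impI)
  fix t :: real assume t: "t \<ge> 0"
  then show "integrable lborel (\<lambda>x. F t x + G t x)"
    using assms by (auto simp: L1_curve_def)
  show "((\<lambda>s. LINT x|lborel. \<bar>F s x + G s x - (F t x + G t x)\<bar>) \<longlongrightarrow> 0) (at t within {0..})"
  proof (rule tendsto_0_if_le)
    let ?B = "\<lambda>s. (LINT x|lborel. \<bar>F s x - F t x\<bar>) + (LINT x|lborel. \<bar>G s x - G t x\<bar>)"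
    have "(?B \<longlongrightarrow> 0 + 0) (at t within {0..})"
      using assms t by (intro tendsto_add) (auto simp: L1_curve_def)
    then show "(?B \<longlongrightarrow> 0) (at t within {0..})" by simp
    show "(LINT x|lborel. \<bar>F s x + G s x - (F t x + G t x)\<bar>) \<le> ?B s" if "s \<in> {0..}" for s
    proof -
      from that have i: "integrable lborel (F s)" "integrable lborel (F t)" "integrable lborel (G s)"
        "integrable lborel (G t)" using assms t by (auto simp: L1_curve_def)
      have "(LINT x|lborel. \<bar>F s x + G s x - (F t x + G t x)\<bar>)
          \<le> (LINT x|lborel. \<bar>F s x - F t x\<bar> + \<bar>G s x - G t x\<bar>)"
        using i by (intro integral_mono) auto
      then show "(LINT x|lborel. \<bar>F s x + G s x - (F t x + G t x)\<bar>) \<le> ?B s"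
        using i by simp
    qed
  qed auto
qed

lemma L1_curve_cmult:
  assumes "L1_curve F" shows "L1_curve (\<lambda>t x. c * F t x)"
  unfolding L1_curve_def
proof (intro conjI allI impI)
  fix t :: real assume t: "t \<ge> 0"
  then show "integrable lborel (\<lambda>x. c * F t x)" using assms by (auto simp: L1_curve_def)
  have "((\<lambda>s. \<bar>c\<bar> * (LINT x|lborel. \<bar>F s x - F t x\<bar>)) \<longlongrightarrow> \<bar>c\<bar> * 0) (at t within {0..})"
    using assms t by (intro tendsto_mult_left) (auto simp: L1_curve_def)
  then show "((\<lambda>s. LINT x|lborel. \<bar>c * F s x - c * F t x\<bar>) \<longlongrightarrow> 0) (at t within {0..})"
    by (simp add: abs_mult flip: right_diff_distrib)
qed

lemma integrable_mult_bounded: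
  fixes F \<psi> :: "real \<Rightarrow> real"
  assumes "integrable lborel F" "\<psi> \<in> borel_measurable borel" "\<And>x. \<bar>\<psi> x\<bar> \<le> M"
  shows "integrable lborel (\<lambda>x. F x * \<psi> x)"
proof (rule Bochner_Integration.integrable_bound)
  show "integrable lborel (\<lambda>x. M * F x)" using assms(1) by simp
  show "AE x in lborel. norm (F x * \<psi> x) \<le> norm (M * F x)"
    using assms(3) abs_ge_self[of M] order_trans
    by (intro AE_I2) (fastforce simp: abs_mult mult.commute[of "\<bar>F _\<bar>"] intro!: mult_right_mono)
qed (use assms borel_measurable_integrable[OF assms(1)] in measurable)

text \<open>Supplies the continuity in time of the flux, which is what upgrades the weak time
  derivative to a classical one.\<close>

lemma L1_curve_continuous:
  assumes F: "L1_curve F" and \<psi>: "\<psi> \<in> borel_measurable borel" "\<And>x. \<bar>\<psi> x\<bar> \<le> M"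
  shows "continuous_on {0..} (\<lambda>t. LINT x|lborel. F t x * \<psi> x)"
  unfolding continuous_on_def
proof
  fix t :: real assume "t \<in> {0..}"
  then have t: "t \<ge> 0" by simp
  show "((\<lambda>t. LINT x|lborel. F t x * \<psi> x) \<longlongrightarrow> (LINT x|lborel. F t x * \<psi> x)) (at t within {0..})"
  proof (rule LIM_zero_cancel, rule tendsto_rabs_zero_cancel, rule tendsto_0_if_le)
    have "((\<lambda>s. M * (LINT x|lborel. \<bar>F s x - F t x\<bar>)) \<longlongrightarrow> M * 0) (at t within {0..})"
      using F t by (intro tendsto_mult_left) (auto simp: L1_curve_def)
    then show "((\<lambda>s. M * (LINT x|lborel. \<bar>F s x - F t x\<bar>)) \<longlongrightarrow> 0) (at t within {0..})" by simp
    show "\<bar>(LINT x|lborel. F s x * \<psi> x) - (LINT x|lborel. F t x * \<psi> x)\<bar>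
        \<le> M * (LINT x|lborel. \<bar>F s x - F t x\<bar>)" if "s \<in> {0..}" for s
    proof -
      from that have i: "integrable lborel (F s)" "integrable lborel (F t)" using F t by (auto simp: L1_curve_def)
      note ip = i[THEN integrable_mult_bounded[OF _ \<psi>]]
      have "\<bar>(LINT x|lborel. F s x * \<psi> x) - (LINT x|lborel. F t x * \<psi> x)\<bar>
          = \<bar>LINT x|lborel. (F s x - F t x) * \<psi> x\<bar>"
        using ip by (simp add: left_diff_distrib)
      also have "\<dots> \<le> (LINT x|lborel. \<bar>(F s x - F t x) * \<psi> x\<bar>)" by (rule integral_abs_bound)
      also have "\<dots> \<le> (LINT x|lborel. M * \<bar>F s x - F t x\<bar>)"
      proof (rule integral_mono)
        show "integrable lborel (\<lambda>x. \<bar>(F s x - F t x) * \<psi> x\<bar>)"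
          using i by (intro integrable_abs integrable_mult_bounded[OF _ \<psi>]) auto
        show "\<bar>(F s x - F t x) * \<psi> x\<bar> \<le> M * \<bar>F s x - F t x\<bar>" for x
          using mult_right_mono[OF \<psi>(2)[of x], of "\<bar>F s x - F t x\<bar>"]
          by (simp add: abs_mult mult.commute)
      qed (use i in auto)
      finally show "\<bar>(LINT x|lborel. F s x * \<psi> x) - (LINT x|lborel. F t x * \<psi> x)\<bar>
        \<le> M * (LINT x|lborel. \<bar>F s x - F t x\<bar>)" by simp
    qed
  qed auto
qed

text \<open>Regarding \<open>\<psi>\<close> as a constant L2 curve, the product is an L1 curve,
  which is tested against the bounded function 1.\<close>

lemma L2_curve_continuous:
  assumes "L2_curve a" "L2 \<psi>"
  shows "continuous_on {0..} (\<lambda>t. LINT x|lborel. a t x * \<psi> x)"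
  using L1_curve_continuous[OF L1_curve_mult[OF assms(1) L2_curve_const[OF assms(2)]], of "\<lambda>x. 1" 1]
  by simp

lemma L2_test_seq: assumes "test_seq d" shows "L2 (d k)"
proof -
  obtain L where L: "L > 0" "\<And>k x. \<bar>x\<bar> > L \<Longrightarrow> d k x = 0"
    by (rule test_seq_support[OF assms], rule that)
  note sm = test_seq_smooth[OF assms]
  have "set_integrable lborel {-L..L} (\<lambda>x. (d k x)\<^sup>2)"
    by (rule borel_integrable_atLeastAtMost', rule continuous_on_subset[of UNIV])
       (auto intro!: continuous_intros smooth_seq_continuous[OF sm])
  moreover have "(\<lambda>x. indicator {-L..L} x *\<^sub>R (d k x)\<^sup>2) = (\<lambda>x. (d k x)\<^sup>2)"
  proof
    fix x show "indicator {-L..L} x *\<^sub>R (d k x)\<^sup>2 = (d k x)\<^sup>2"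
      using L(2)[of x k] by (cases "\<bar>x\<bar> > L") (auto simp: indicator_def abs_if split: if_splits)
  qed
  ultimately show ?thesis
    by (simp add: L2_def set_integrable_def smooth_seq_measurable[OF sm])
qed

subsection \<open>Continuity of translations\<close>

definition L1_translation_continuous :: "(real \<Rightarrow> real) \<Rightarrow> bool" where
  "L1_translation_continuous f \<longleftrightarrow> ((\<lambda>h. LINT x|lborel. \<bar>f (x + h) - f x\<bar>) \<longlongrightarrow> 0) (at 0)"

lemma integrable_shift: "integrable lborel f \<Longrightarrow> integrable lborel (\<lambda>x. f (x + h :: real) :: real)"
  using lborel_integrable_real_affine[of f 1 h] by (simp add: add.commute)

lemma integral_shift: "(LINT x|lborel. f (x + h)) = (LINT x|lborel. f x)" for f :: "real \<Rightarrow> real"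
  using lborel_integral_real_affine[of 1 f h] by (simp add: add.commute)

text \<open>A three-epsilon argument: by translation invariance the approximation error after the
  shift equals the error before it, so it is small uniformly in \<open>h\<close>.\<close>

lemma L1_translation_continuous_approx:
  assumes f: "integrable lborel f"
    and approx: "\<And>e. e > 0 \<Longrightarrow> \<exists>g. integrable lborel g \<and> L1_translation_continuous g
                   \<and> (LINT x|lborel. \<bar>f x - g x\<bar>) < e"
  shows "L1_translation_continuous f"
  unfolding L1_translation_continuous_def
proof (rule tendstoI)
  fix e :: real assume "e > 0"
  then obtain g where g: "integrable lborel g" "L1_translation_continuous g"
    "(LINT x|lborel. \<bar>f x - g x\<bar>) < e / 3"
    using approx[of "e / 3"] by auto
  have "\<forall>\<^sub>F h in at 0. dist (LINT x|lborel. \<bar>g (x + h) - g x\<bar>) 0 < e / 3"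
    using g(2) \<open>e > 0\<close> unfolding L1_translation_continuous_def by (intro tendstoD) auto
  then show "\<forall>\<^sub>F h in at 0. dist (LINT x|lborel. \<bar>f (x + h) - f x\<bar>) 0 < e"
  proof eventually_elim
    case (elim h)
    note i = f g(1) integrable_shift[OF f, of h] integrable_shift[OF g(1), of h]
    have "(LINT x|lborel. \<bar>f (x + h) - f x\<bar>)
        \<le> (LINT x|lborel. \<bar>f (x + h) - g (x + h)\<bar> + \<bar>g (x + h) - g x\<bar> + \<bar>f x - g x\<bar>)"
      using i by (intro integral_mono) auto
    also have "\<dots> = (LINT x|lborel. \<bar>f (x + h) - g (x + h)\<bar>) + (LINT x|lborel. \<bar>g (x + h) - g x\<bar>)
        + (LINT x|lborel. \<bar>f x - g x\<bar>)"
      using i by simp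
    also have "(LINT x|lborel. \<bar>f (x + h) - g (x + h)\<bar>) = (LINT x|lborel. \<bar>f x - g x\<bar>)"
      by (rule integral_shift[of "\<lambda>x. \<bar>f x - g x\<bar>"])
    finally show ?case using g(3) elim by (simp add: dist_real_def)
  qed
qed

text \<open>Since translations preserve the measure of U, the L1-distance between the indicators of U and
  of its translate is twice the measure of the part of U that leaves U.\<close>

lemma L1_translation_continuous_open:
  assumes U: "open U" "emeasure lborel U < \<infinity>"
  shows "L1_translation_continuous (indicator U)"
  unfolding L1_translation_continuous_def tendsto_at_iff_sequentially comp_def
proof (intro allI impI)
  fix X :: "nat \<Rightarrow> real" assume X: "X \<longlonglongrightarrow> 0"
  let ?I = "indicator U :: real \<Rightarrow> real"
  have [measurable]: "U \<in> sets borel" using U by simp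
  have iU: "integrable lborel ?I" using U by simp
  have eq: "(LINT x|lborel. \<bar>?I (x + h) - ?I x\<bar>) = 2 * (LINT x|lborel. ?I x * (1 - ?I (x + h)))" for h
  proof -
    have i1: "integrable lborel (\<lambda>x. ?I x * (1 - ?I (x + h)))"
      by (rule Bochner_Integration.integrable_bound[OF iU]) (auto simp: indicator_def)
    have "(LINT x|lborel. \<bar>?I (x + h) - ?I x\<bar>)
        = (LINT x|lborel. 2 * (?I x * (1 - ?I (x + h))) + (?I (x + h) - ?I x))"
      by (intro Bochner_Integration.integral_cong) (auto simp: indicator_def)
    also have "\<dots> = 2 * (LINT x|lborel. ?I x * (1 - ?I (x + h)))
        + ((LINT x|lborel. ?I (x + h)) - (LINT x|lborel. ?I x))"
      using i1 iU integrable_shift[OF iU, of h] by simp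
    also have "(LINT x|lborel. ?I (x + h)) = (LINT x|lborel. ?I x)" by (rule integral_shift)
    finally show ?thesis by simp
  qed
  have "(\<lambda>n. LINT x|lborel. ?I x * (1 - ?I (x + X n))) \<longlonglongrightarrow> (LINT x::real|lborel. 0)"
  proof (rule integral_dominated_convergence[where w="?I"])
    show "integrable lborel ?I" by (rule iU)
    show "AE x in lborel. (\<lambda>n. ?I x * (1 - ?I (x + X n))) \<longlonglongrightarrow> 0"
    proof (rule AE_I2)
      fix x :: real
      show "(\<lambda>n. ?I x * (1 - ?I (x + X n))) \<longlonglongrightarrow> 0"
      proof (cases "x \<in> U")
        case True
        have "(\<lambda>n. x + X n) \<longlonglongrightarrow> x" using tendsto_add[OF tendsto_const[of x] X] by simp
        then have "\<forall>\<^sub>F n in sequentially. x + X n \<in> U"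
          using U(1) True topological_tendstoD by blast
        then have "\<forall>\<^sub>F n in sequentially. ?I x * (1 - ?I (x + X n)) = 0"
          by eventually_elim simp
        then show ?thesis by (rule tendsto_eventually)
      qed simp
    qed
  qed (auto simp: indicator_def)
  then have "(\<lambda>n. 2 * (LINT x|lborel. ?I x * (1 - ?I (x + X n)))) \<longlonglongrightarrow> 2 * 0"
    by (intro tendsto_mult_left) simp
  then show "(\<lambda>n. LINT x|lborel. \<bar>?I (x + X n) - ?I x\<bar>) \<longlonglongrightarrow> 0"
    unfolding eq by simp
qed

lemma L1_translation_continuous_cmult:
  assumes "L1_translation_continuous f" shows "L1_translation_continuous (\<lambda>x. f x *\<^sub>R c)"
proof -
  have "((\<lambda>h. \<bar>c\<bar> * (LINT x|lborel. \<bar>f (x + h) - f x\<bar>)) \<longlongrightarrow> \<bar>c\<bar> * 0) (at 0)"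
    using assms unfolding L1_translation_continuous_def by (rule tendsto_mult_left)
  moreover have "\<bar>f (x + h) * c - f x * c\<bar> = \<bar>c\<bar> * \<bar>f (x + h) - f x\<bar>" for x h
    by (simp add: mult.commute flip: right_diff_distrib abs_mult)
  ultimately show ?thesis by (simp add: L1_translation_continuous_def)
qed

text \<open>Induction over integrable functions. An indicator of a set of finite measure is
  approximated by that of an open superset through outer regularity; limits are handled by the
  approximation lemma.\<close>

lemma L1_translation_continuous_integrable:
  fixes f :: "real \<Rightarrow> real"
  assumes "integrable lborel f" shows "L1_translation_continuous f"
  using assms
proof (induction rule: integrable_induct)
  case (base A c)
  then have A[measurable]: "A \<in> sets borel" and fin: "emeasure lborel A < \<infinity>" by auto
  have iA: "integrable lborel (indicator A :: real \<Rightarrow> real)" using base by simp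
  have "L1_translation_continuous (indicator A)"
  proof (rule L1_translation_continuous_approx[OF iA])
    fix e :: real assume "e > 0"
    obtain U where U: "open U" "A \<subseteq> U" "emeasure lborel (U - A) < e"
      using outer_regular_lborel[OF A \<open>e > 0\<close>] by metis
    have [measurable]: "U \<in> sets borel" using U by simp
    have "emeasure lborel U = emeasure lborel A + emeasure lborel (U - A)"
      using U by (subst plus_emeasure) (auto simp: Un_absorb1)
    also have "\<dots> < \<infinity>" using fin order.strict_trans[OF U(3) ennreal_less_top] by (simp add: less_top)
    finally have Ufin: "emeasure lborel U < \<infinity>" .
    have "(LINT x|lborel. \<bar>indicator A x - indicator U x :: real\<bar>) = (LINT x|lborel. indicator (U - A) x)"
      using U(2) by (intro Bochner_Integration.integral_cong) (auto simp: indicator_def)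
    also have "\<dots> = measure lborel (U - A)" by simp
    also have "\<dots> < e" using U(3) order.strict_trans[OF U(3) ennreal_less_top] \<open>e > 0\<close>
      by (simp add: emeasure_eq_ennreal_measure ennreal_less_iff less_top)
    finally show "\<exists>g. integrable lborel g \<and> L1_translation_continuous g
         \<and> (LINT x|lborel. \<bar>indicator A x - g x\<bar>) < e"
      using L1_translation_continuous_open[OF U(1) Ufin] Ufin
      by (intro exI[of _ "indicator U"]) auto
  qed
  then show ?case by (rule L1_translation_continuous_cmult)
next
  case (add f g)
  show ?case
    unfolding L1_translation_continuous_def
  proof (rule tendsto_0_if_le)
    let ?B = "\<lambda>h. (LINT x|lborel. \<bar>f (x + h) - f x\<bar>) + (LINT x|lborel. \<bar>g (x + h) - g x\<bar>)"
    have "(?B \<longlongrightarrow> 0 + 0) (at 0)"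
      using add unfolding L1_translation_continuous_def by (intro tendsto_add) auto
    then show "(?B \<longlongrightarrow> 0) (at 0)" by simp
    show "(LINT x|lborel. \<bar>f (x + h) + g (x + h) - (f x + g x)\<bar>) \<le> ?B h" for h
    proof -
      note i = add.hyps add.hyps[THEN integrable_shift[where h=h]]
      have "(LINT x|lborel. \<bar>f (x + h) + g (x + h) - (f x + g x)\<bar>)
          \<le> (LINT x|lborel. \<bar>f (x + h) - f x\<bar> + \<bar>g (x + h) - g x\<bar>)"
        using i by (intro integral_mono) auto
      then show "(LINT x|lborel. \<bar>f (x + h) + g (x + h) - (f x + g x)\<bar>) \<le> ?B h"
        using i by simp
    qed
  qed auto
next
  case (lim f s)
  \<comment> \<open>The approximants of the induction rule satisfy
    \<open>\<bar>s i x\<bar> \<le> 2 * \<bar>f x\<bar>\<close>, which explains the majorant with the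
    factor 3.\<close>
  have "(\<lambda>i. LINT x|lborel. \<bar>f x - s i x\<bar>) \<longlonglongrightarrow> (LINT x::real|lborel. 0)"
  proof (rule integral_dominated_convergence[where w="\<lambda>x. 3 * \<bar>f x\<bar>"])
    show "integrable lborel (\<lambda>x. 3 * \<bar>f x\<bar>)" using lim by simp
    show "AE x in lborel. (\<lambda>i. \<bar>f x - s i x\<bar>) \<longlonglongrightarrow> 0"
      using lim.hyps(2) tendsto_rabs_zero[OF LIM_zero[of "\<lambda>i. s i x" "f x" for x]] 
      by (intro AE_I2) (simp add: abs_minus_commute)
    show "AE x in lborel. norm \<bar>f x - s i x\<bar> \<le> 3 * \<bar>f x\<bar>" for i
    proof (rule AE_I2)
      fix x show "norm \<bar>f x - s i x\<bar> \<le> 3 * \<bar>f x\<bar>" using lim.hyps(3)[of x i] by simp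
    qed
  qed (use lim borel_measurable_integrable in auto)
  then have conv: "(\<lambda>i. LINT x|lborel. \<bar>f x - s i x\<bar>) \<longlonglongrightarrow> 0" by simp
  show ?case
  proof (rule L1_translation_continuous_approx[OF lim.hyps(4)])
    fix e :: real assume "e > 0"
    have "\<forall>\<^sub>F i in sequentially. (LINT x|lborel. \<bar>f x - s i x\<bar>) < e"
      using order_tendstoD(2)[OF conv \<open>e > 0\<close>] .
    then obtain i where "(LINT x|lborel. \<bar>f x - s i x\<bar>) < e"
      by (auto simp: eventually_sequentially)
    then show "\<exists>g. integrable lborel g \<and> L1_translation_continuous g \<and> (LINT x|lborel. \<bar>f x - g x\<bar>) < e"
      using lim by blast
  qed
qed

text \<open>Bounds the L2-modulus of continuity of f by the L1-modulus of f |f|.\<close>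

lemma signed_square_diff: "(a - b)\<^sup>2 \<le> 2 * \<bar>a * \<bar>a\<bar> - b * \<bar>b\<bar>\<bar>" for a b :: real
proof -
  have same: "(a - b)\<^sup>2 \<le> \<bar>a\<^sup>2 - b\<^sup>2\<bar>" if "0 \<le> a" "0 \<le> b" for a b :: real
  proof -
    have "\<bar>a - b\<bar> * \<bar>a - b\<bar> \<le> \<bar>a + b\<bar> * \<bar>a - b\<bar>"
      using that by (intro mult_right_mono) auto
    then show ?thesis by (simp add: power2_eq_square square_diff_square_factored flip: abs_mult)
  qed
  \<comment> \<open>Only opposite signs require the factor 2: there
    \<open>a * \<bar>a\<bar> - b * \<bar>b\<bar>\<close> has absolute value
    \<open>a\<^sup>2 + b\<^sup>2\<close>.\<close>
  have opp: "(a + b)\<^sup>2 \<le> 2 * (a\<^sup>2 + b\<^sup>2)" for a b :: real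
    using sum_squares_bound[of a b] by (simp add: power2_sum)
  consider "0 \<le> a" "0 \<le> b" | "a \<le> 0" "b \<le> 0" | "0 \<le> a" "b \<le> 0" | "a \<le> 0" "0 \<le> b" by linarith
  then show ?thesis
  proof cases
    case 1
    then have "(a - b)\<^sup>2 \<le> \<bar>a\<^sup>2 - b\<^sup>2\<bar>" using same by blast
    also have "\<dots> \<le> 2 * \<bar>a\<^sup>2 - b\<^sup>2\<bar>" by simp
    finally show ?thesis using 1 by (simp add: power2_eq_square)
  next
    case 2
    then have "(a - b)\<^sup>2 \<le> \<bar>a\<^sup>2 - b\<^sup>2\<bar>" using same[of "-a" "-b"] by (simp add: power2_commute)
    also have "\<dots> \<le> 2 * \<bar>a\<^sup>2 - b\<^sup>2\<bar>" by simp
    finally show ?thesis using 2 by (simp add: power2_eq_square abs_minus_commute)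
  next
    case 3
    then show ?thesis using opp[of a "-b"] by (simp add: power2_eq_square)
  next
    case 4
    then show ?thesis using opp[of a "-b"] by (simp add: power2_eq_square)
  qed
qed

text \<open>The L1 result is applied to the integrable function \<open>f * \<bar>f\<bar>\<close>.
  The square of \<open>f\<close> would not do, since it forgets sign changes.\<close>

lemma L2_translation_continuous:
  assumes f: "L2 f"
  shows "((\<lambda>h. LINT x|lborel. (f (x + h) - f x)\<^sup>2) \<longlongrightarrow> 0) (at 0)"
proof -
  define p where "p x = f x * \<bar>f x\<bar>" for x
  have ip: "integrable lborel p" unfolding p_def by (rule L2_mult_integrable[OF f L2_abs[OF f]])
  have "((\<lambda>h. 2 * (LINT x|lborel. \<bar>p (x + h) - p x\<bar>)) \<longlongrightarrow> 2 * 0) (at 0)"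
    using L1_translation_continuous_integrable[OF ip]
    unfolding L1_translation_continuous_def by (rule tendsto_mult_left)
  then have lim: "((\<lambda>h. 2 * (LINT x|lborel. \<bar>p (x + h) - p x\<bar>)) \<longlongrightarrow> 0) (at 0)" by simp
  have le: "(LINT x|lborel. (f (x + h) - f x)\<^sup>2) \<le> 2 * (LINT x|lborel. \<bar>p (x + h) - p x\<bar>)" for h
  proof -
    have "L2 (\<lambda>x. f (x + h))" using L2_affine[OF f, of 1 h] by (simp add: add.commute)
    from L2_diff[OF this f] have "integrable lborel (\<lambda>x. (f (x + h) - f x)\<^sup>2)" by (simp add: L2_def)
    moreover have "integrable lborel (\<lambda>x. \<bar>p (x + h) - p x\<bar>)" using ip integrable_shift[OF ip] by auto
    ultimately have "(LINT x|lborel. (f (x + h) - f x)\<^sup>2) \<le> (LINT x|lborel. 2 * \<bar>p (x + h) - p x\<bar>)"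
      by (intro integral_mono) (auto simp: p_def intro: signed_square_diff)
    then show ?thesis by simp
  qed
  show ?thesis
    by (rule tendsto_sandwich[OF _ _ tendsto_const lim]) (auto simp: le)
qed

text \<open>By translation invariance the L2 distance between two times depends only on the relative
  shift \<open>c * (s - t)\<close>, so continuity in time reduces to continuity of translations at
  0.\<close>

lemma L2_curve_travelling:
  assumes f: "L2 f" shows "L2_curve (\<lambda>t x. f (x - c * (t - t0)))"
  unfolding L2_curve_def
proof (intro conjI allI impI)
  show "L2 (\<lambda>x. f (x - c * (t - t0)))" for t using L2_affine[OF f, of 1 "- (c * (t - t0))"] by simp
  fix t :: real
  define T where "T h = (LINT x|lborel. (f (x + h) - f x)\<^sup>2)" for h
  have "isCont T 0"
    using L2_translation_continuous[OF f] unfolding isCont_def T_def[abs_def] by simp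
  moreover have "((\<lambda>s. - (c * (s - t))) \<longlongrightarrow> 0) (at t within {0..})"
    by (auto intro!: tendsto_eq_intros)
  ultimately have "((\<lambda>s. T (- (c * (s - t)))) \<longlongrightarrow> T 0) (at t within {0..})"
    by (rule isCont_tendsto_compose)
  moreover have "T (- (c * (s - t))) = (LINT x|lborel. (f (x - c * (s - t0)) - f (x - c * (t - t0)))\<^sup>2)" for s
    using integral_shift[of "\<lambda>x. (f (x - c * (s - t)) - f x)\<^sup>2" "- (c * (t - t0))"]
    by (simp add: T_def algebra_simps)
  ultimately show "((\<lambda>s. LINT x|lborel. (f (x - c * (s - t0)) - f (x - c * (t - t0)))\<^sup>2) \<longlongrightarrow> 0) (at t within {0..})"
    by (simp add: T_def)
qed

subsection \<open>Weak derivatives and reflections\<close>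

lemma weak_deriv_test_seq:
  assumes "weak_deriv f g" "test_seq d"
  shows "(LINT x|lborel. f x * d 1 x) = - (LINT x|lborel. g x * d 0 x)"
proof -
  have "deriv (d 0) = d 1"
    using smooth_seq_funpow_deriv[OF test_seq_smooth[OF assms(2)], of 1] by simp
  then show ?thesis
    using assms(1) test_seq_imp_test1[OF assms(2)] unfolding weak_deriv_def by metis
qed

lemma weak_derivI_test_seq:
  assumes "\<And>d. test_seq d \<Longrightarrow> (LINT x|lborel. f x * d 1 x) = - (LINT x|lborel. g x * d 0 x)"
  shows "weak_deriv f g"
  unfolding weak_deriv_def using assms[OF test1_imp_test_seq] by simp

text \<open>The change of variables is moved onto the test function, which is composed with the
  inverse affine map. The case \<open>c = 1\<close> serves the travelling wave,
  \<open>c = -1\<close> the reflection.\<close>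

lemma weak_deriv_affine:
  assumes "weak_deriv f g" "c \<noteq> 0"
  shows "weak_deriv (\<lambda>x. f (a + c * x)) (\<lambda>x. c * g (a + c * x))"
proof (rule weak_derivI_test_seq)
  fix d assume d: "test_seq d"
  define e where "e k y = (1 / c) ^ k * d k (- (a / c) + (1 / c) * y)" for k y
  have e: "test_seq e" unfolding e_def using assms(2) by (intro test_seq_affine d) auto
  have inv: "- (a / c) + (1 / c) * (a + c * x) = x" for x using assms(2) by (simp add: field_simps)
  have "(LINT y|lborel. f y * e 1 y) = \<bar>c\<bar> * (LINT x|lborel. f (a + c * x) * e 1 (a + c * x))"
    using lborel_integral_real_affine[OF assms(2), of "\<lambda>y. f y * e 1 y" a] by simp
  also have "(LINT x|lborel. f (a + c * x) * e 1 (a + c * x)) = (LINT x|lborel. (1 / c) * (f (a + c * x) * d 1 x))"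
    unfolding e_def inv by (intro Bochner_Integration.integral_cong) auto
  also have "\<dots> = (1 / c) * (LINT x|lborel. f (a + c * x) * d 1 x)" by (rule integral_mult_right_zero)
  finally have 1: "(LINT y|lborel. f y * e 1 y) = \<bar>c\<bar> * ((1 / c) * (LINT x|lborel. f (a + c * x) * d 1 x))" .
  have "(LINT y|lborel. g y * e 0 y) = \<bar>c\<bar> * (LINT x|lborel. g (a + c * x) * e 0 (a + c * x))"
    using lborel_integral_real_affine[OF assms(2), of "\<lambda>y. g y * e 0 y" a] by simp
  also have "(LINT x|lborel. g (a + c * x) * e 0 (a + c * x)) = (LINT x|lborel. g (a + c * x) * d 0 x)"
    unfolding e_def inv by (intro Bochner_Integration.integral_cong) auto
  finally have 2: "(LINT y|lborel. g y * e 0 y) = \<bar>c\<bar> * (LINT x|lborel. g (a + c * x) * d 0 x)" .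
  have cancel: "X = - (c * Y)" if "\<bar>c\<bar> * ((1 / c) * X) = - (\<bar>c\<bar> * Y)" for X Y
  proof -
    have "\<bar>c\<bar> * ((1 / c) * X + Y) = 0" using that by (simp add: distrib_left)
    then have "(1 / c) * X + Y = 0" using assms(2) by simp
    then show ?thesis using assms(2) by (simp add: field_simps)
  qed
  have "\<bar>c\<bar> * ((1 / c) * (LINT x|lborel. f (a + c * x) * d 1 x))
      = - (\<bar>c\<bar> * (LINT x|lborel. g (a + c * x) * d 0 x))"
    using weak_deriv_test_seq[OF assms(1) e] unfolding 1 2 .
  then have "(LINT x|lborel. f (a + c * x) * d 1 x) = - (c * (LINT x|lborel. g (a + c * x) * d 0 x))"
    using cancel by blast
  then show "(LINT x|lborel. f (a + c * x) * d 1 x) = - (LINT x|lborel. c * g (a + c * x) * d 0 x)"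
    by (simp add: mult.assoc)
qed

lemma L2_indicator: "L2 (indicator {a..b} :: real \<Rightarrow> real)"
proof -
  have "(\<lambda>x. (indicator {a..b} x :: real)\<^sup>2) = indicator {a..b}" by (auto simp: indicator_def)
  then show ?thesis by (auto simp: L2_def emeasure_lborel_Icc_eq)
qed

text \<open>The difference of the two weak derivatives is orthogonal to all test functions; as an L2
  function it is locally integrable, hence zero a.e.\<close>

lemma weak_deriv_unique:
  assumes f: "AE x in lborel. f1 x = f2 x" "f1 \<in> borel_measurable borel" "f2 \<in> borel_measurable borel"
    and w: "weak_deriv f1 g1" "weak_deriv f2 g2" and L: "L2 g1" "L2 g2"
  shows "AE x in lborel. g1 x = g2 x"
proof -
  note Ld = L2_diff[OF L]
  have "AE x in lborel. g1 x - g2 x = 0"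
  proof (rule AE_eq_0_if_orthogonal_to_tests)
    show "(\<lambda>x. g1 x - g2 x) \<in> borel_measurable borel" using Ld by (simp add: L2_def)
    show "integrable lborel (\<lambda>x. (g1 x - g2 x) * indicator {- B..B} x)" for B
      by (rule L2_mult_integrable[OF Ld L2_indicator])
    fix d assume d: "test_seq d"
    have [measurable]: "d k \<in> borel_measurable borel" for k
      by (rule smooth_seq_measurable[OF test_seq_smooth[OF d]])
    have "(LINT x|lborel. f1 x * d 1 x) = (LINT x|lborel. f2 x * d 1 x)"
      using f by (intro integral_cong_AE) (auto elim: eventually_mono)
    then have "(LINT x|lborel. g1 x * d 0 x) = (LINT x|lborel. g2 x * d 0 x)"
      using weak_deriv_test_seq[OF w(1) d] weak_deriv_test_seq[OF w(2) d] by simp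
    then show "(LINT x|lborel. (g1 x - g2 x) * d 0 x) = 0"
      using L2_mult_integrable[OF L(1) L2_test_seq[OF d]] L2_mult_integrable[OF L(2) L2_test_seq[OF d]]
      by (simp add: left_diff_distrib)
  qed
  then show ?thesis by simp
qed

text \<open>Reflecting \<open>f\<close> yields \<open>- g (p - x)\<close> as a weak derivative of a
  function that agrees with \<open>f\<close> a.e.; uniqueness identifies it with
  \<open>g\<close>.\<close>

lemma weak_deriv_of_even_is_odd:
  assumes "L2 f" "L2 g" "weak_deriv f g" "AE x in lborel. f x = f (p - x)"
  shows "AE x in lborel. g x = - g (p - x)"
proof -
  have "AE x in lborel. g x = - 1 * g (p + - 1 * x)"
  proof (rule weak_deriv_unique[OF _ _ _ assms(3) weak_deriv_affine[OF assms(3)]])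
    show "AE x in lborel. f x = f (p + - 1 * x)" using assms(4) by simp
    show "f \<in> borel_measurable borel" "(\<lambda>x. f (p + - 1 * x)) \<in> borel_measurable borel"
      using assms(1) by (auto simp: L2_def)
    show "L2 (\<lambda>x. - 1 * g (p + - 1 * x))" by (intro L2_cmult L2_affine assms) simp
  qed (use assms in auto)
  then show ?thesis by simp
qed

lemma integral_reflect: "(LINT x|lborel. f (p - x)) = (LINT x|lborel. f x)" for f :: "real \<Rightarrow> real"
  using lborel_integral_real_affine[of "-1" f p] by simp

subsection \<open>Differentiation along a moving test function\<close>

text \<open>Needed because the remainder estimate along a moving test function involves the integral
  of \<open>\<bar>a\<bar>\<close> over a bounded interval. Taking absolute values is a contraction
  by the reverse triangle inequality.\<close>

lemma L2_curve_abs: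
  assumes "L2_curve a" shows "L2_curve (\<lambda>t x. \<bar>a t x\<bar>)"
  unfolding L2_curve_def
proof (intro conjI allI impI)
  fix t :: real assume t: "t \<ge> 0"
  then show "L2 (\<lambda>x. \<bar>a t x\<bar>)" using assms by (simp add: L2_curve_def L2_abs)
  show "((\<lambda>s. LINT x|lborel. (\<bar>a s x\<bar> - \<bar>a t x\<bar>)\<^sup>2) \<longlongrightarrow> 0) (at t within {0..})"
  proof (rule tendsto_0_if_le)
    show "((\<lambda>s. LINT x|lborel. (a s x - a t x)\<^sup>2) \<longlongrightarrow> 0) (at t within {0..})"
      using assms t by (simp add: L2_curve_def)
    fix s :: real assume "s \<in> {0..}"
    then have L: "L2 (a s)" "L2 (a t)" using assms t by (auto simp: L2_curve_def)
    have "(\<bar>a s x\<bar> - \<bar>a t x\<bar>)\<^sup>2 \<le> (a s x - a t x)\<^sup>2" for x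
      by (metis abs_triangle_ineq3 abs_le_square_iff abs_abs)
    then show "(LINT x|lborel. (\<bar>a s x\<bar> - \<bar>a t x\<bar>)\<^sup>2) \<le> (LINT x|lborel. (a s x - a t x)\<^sup>2)"
      using L2_diff[OF L] L2_diff[OF L2_abs[OF L(1)] L2_abs[OF L(2)]]
      by (intro integral_mono) (auto simp: L2_def)
  qed simp
qed

text \<open>Curves are controlled for nonnegative times only. Freezing them at time 0 for negative
  arguments gives functions on the whole line, to which two-sided derivatives and integrals over the
  line apply.\<close>

lemma continuous_on_max_0:
  assumes "continuous_on {0..} (f :: real \<Rightarrow> real)" shows "continuous_on UNIV (\<lambda>t. f (max 0 t))"
  by (rule continuous_on_compose2[OF assms]) (auto intro!: continuous_intros)

text \<open>The indicator is essential: the remainder is paired with a function that is merely L2,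
  and a bound without compact support could not be integrated against it. The support grows by 1
  because \<open>\<bar>h\<bar> \<le> 1\<close>.\<close>

lemma test_seq_Taylor:
  assumes K: "test_seq K"
  obtains M L where "M > 0" "L > 0"
    "\<And>z h. \<bar>h\<bar> \<le> 1 \<Longrightarrow> \<bar>K 0 (z - h) - K 0 z + h * K 1 z\<bar> \<le> M * h\<^sup>2 * indicator {-L..L} z"
proof -
  obtain L where L: "L > 0" "\<And>k x. \<bar>x\<bar> > L \<Longrightarrow> K k x = 0"
    by (rule test_seq_support[OF K], rule that)
  obtain M where M: "M > 0" "\<And>x. \<bar>K 2 x\<bar> \<le> M" by (rule test_seq_bounded[OF K, of 2], rule that)
  note D = smooth_seq_DERIV[OF test_seq_smooth[OF K]]
  have lip: "\<bar>K 1 y - K 1 z\<bar> \<le> M * \<bar>y - z\<bar>" for y z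
  proof -
    have "(K 1 has_real_derivative K 2 x) (at x)" for x
      using D[of 1 x] by (simp add: numeral_2_eq_2)
    then have "norm (K 1 y - K 1 z) \<le> M * norm (y - z)"
      using M(2) by (intro field_differentiable_bound[where S=UNIV and f'="K 2"]) simp_all
    then show ?thesis by simp
  qed
  have taylor: "\<bar>K 0 (z - h) - K 0 z + h * K 1 z\<bar> \<le> M * h\<^sup>2" for z h
  proof -
    \<comment> \<open>Mean value estimate for \<open>K 0 y - K 1 z * y\<close>, whose derivative
      \<open>K 1 y - K 1 z\<close> is at most \<open>M * \<bar>h\<bar>\<close> on the
      segment.\<close>
    have "norm ((K 0 (z - h) - K 1 z * (z - h)) - (K 0 z - K 1 z * z)) \<le> (M * \<bar>h\<bar>) * norm ((z - h) - z)"
    proof (rule field_differentiable_bound[where S="closed_segment (z - h) z" and f'="\<lambda>y. K 1 y - K 1 z"])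
      show "((\<lambda>y. K 0 y - K 1 z * y) has_field_derivative K 1 y - K 1 z) (at y within closed_segment (z - h) z)" for y
        using has_field_derivative_at_within[OF DERIV_diff[OF D[of 0 y] DERIV_cmult_Id]] by simp
      show "norm (K 1 y - K 1 z) \<le> M * \<bar>h\<bar>" if "y \<in> closed_segment (z - h) z" for y
      proof -
        have "\<bar>y - z\<bar> \<le> \<bar>h\<bar>" using that by (auto simp: closed_segment_eq_real_ivl split: if_splits)
        then have "M * \<bar>y - z\<bar> \<le> M * \<bar>h\<bar>" using M(1) by simp
        with lip[of y z] show ?thesis unfolding real_norm_def by (rule order_trans)
      qed
    qed auto
    then show ?thesis by (simp add: algebra_simps power2_eq_square abs_mult)
  qed
  show ?thesis
  proof (rule that[of M "L + 1"])
    fix z h :: real assume h: "\<bar>h\<bar> \<le> 1"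
    show "\<bar>K 0 (z - h) - K 0 z + h * K 1 z\<bar> \<le> M * h\<^sup>2 * indicator {-(L+1)..L+1} z"
    proof (cases "\<bar>z\<bar> \<le> L + 1")
      case True
      then show ?thesis using taylor[of z h] by (auto simp: indicator_def abs_le_iff)
    next
      case False
      then have "\<bar>z\<bar> > L" "\<bar>z - h\<bar> > L" using h by linarith+
      then show ?thesis using L(2) M(1) by simp
    qed
  qed (use M L in auto)
qed

text \<open>The difference of translates vanishes at \<open>s = t\<close>, so in the product rule
  the term with the derivative of \<open>a\<close> drops out and L2 continuity of \<open>a\<close>
  is enough. Taylor expansion reduces the claim to \<open>- h s * P s\<close> plus a remainder
  quadratic in \<open>h s\<close>, with \<open>P\<close> and \<open>Q\<close> continuous in
  time.\<close>

lemma DERIV_moving_test_function: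
  assumes a: "L2_curve a" and K: "test_seq K" and \<sigma>: "(\<sigma> has_real_derivative \<sigma>') (at t)" and t: "t > 0"
  shows "((\<lambda>s. LINT y|lborel. a (max 0 s) y * (K 0 (y - \<sigma> s) - K 0 (y - \<sigma> t))) has_real_derivative
           - \<sigma>' * (LINT y|lborel. a t y * K 1 (y - \<sigma> t))) (at t)"
proof -
  obtain M L where M: "M > 0" "L > 0"
    "\<And>z h. \<bar>h\<bar> \<le> 1 \<Longrightarrow> \<bar>K 0 (z - h) - K 0 z + h * K 1 z\<bar> \<le> M * h\<^sup>2 * indicator {-L..L} z"
    by (rule test_seq_Taylor[OF K], rule that)
  define I where "I y = (indicator {\<sigma> t - L..\<sigma> t + L} y :: real)" for y
  have LI: "L2 I" unfolding I_def by (rule L2_indicator)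
  define h where "h s = \<sigma> s - \<sigma> t" for s
  define P where "P s = (LINT y|lborel. a (max 0 s) y * K 1 (y - \<sigma> t))" for s
  define Q where "Q s = (LINT y|lborel. \<bar>a (max 0 s) y\<bar> * I y)" for s
  define E where "E s = (LINT y|lborel. a (max 0 s) y * (K 0 (y - \<sigma> s) - K 0 (y - \<sigma> t)))" for s
  have LK: "L2 (\<lambda>y. K k (y - p))" for k p
    using L2_affine[OF L2_test_seq[OF K], of 1 k "-p"] by simp
  have La: "L2 (a (max 0 s))" for s using a by (simp add: L2_curve_def)
  have rem: "\<bar>E s + h s * P s\<bar> \<le> M * (h s)\<^sup>2 * Q s" if "\<bar>h s\<bar> \<le> 1" for s
  proof -
    define r where "r y = K 0 (y - \<sigma> s) - K 0 (y - \<sigma> t) + h s * K 1 (y - \<sigma> t)" for y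
    have Lr: "L2 r" unfolding r_def by (intro L2_add L2_diff L2_cmult LK)
    have rle: "\<bar>r y\<bar> \<le> M * (h s)\<^sup>2 * I y" for y
      using M(3)[OF that, of "y - \<sigma> t"] by (auto simp: r_def h_def I_def indicator_def algebra_simps split: if_splits)
    have "E s + h s * P s = (LINT y|lborel. a (max 0 s) y * r y)"
      unfolding E_def P_def r_def integral_mult_right_zero[symmetric]
      by (subst Bochner_Integration.integral_add[symmetric])
         (auto intro!: L2_mult_integrable L2_diff LK La Bochner_Integration.integral_cong
           integrable_mult_right simp: algebra_simps simp del: integral_mult_right_zero)
    also have "\<bar>\<dots>\<bar> \<le> (LINT y|lborel. \<bar>a (max 0 s) y * r y\<bar>)" by (rule integral_abs_bound)
    also have "\<dots> \<le> (LINT y|lborel. M * (h s)\<^sup>2 * (\<bar>a (max 0 s) y\<bar> * I y))"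
    proof (rule integral_mono)
      show "integrable lborel (\<lambda>y. \<bar>a (max 0 s) y * r y\<bar>)"
        by (intro integrable_abs L2_mult_integrable La Lr)
      show "integrable lborel (\<lambda>y. M * (h s)\<^sup>2 * (\<bar>a (max 0 s) y\<bar> * I y))"
        by (intro integrable_mult_right L2_mult_integrable L2_abs La LI)
      show "\<bar>a (max 0 s) y * r y\<bar> \<le> M * (h s)\<^sup>2 * (\<bar>a (max 0 s) y\<bar> * I y)" for y
        using mult_left_mono[OF rle[of y], of "\<bar>a (max 0 s) y\<bar>"] by (simp add: abs_mult mult_ac)
    qed
    also have "\<dots> = M * (h s)\<^sup>2 * Q s" by (simp add: Q_def)
    finally show ?thesis .
  qed
  have "continuous_on UNIV P" unfolding P_def
    by (rule continuous_on_max_0[OF L2_curve_continuous[OF a LK]])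
  then have Plim: "(P \<longlongrightarrow> P t) (at t)" by (simp add: continuous_on_eq_continuous_at isCont_def)
  have "continuous_on UNIV Q" unfolding Q_def
    by (rule continuous_on_max_0[OF L2_curve_continuous[OF L2_curve_abs[OF a] LI]])
  then have Qlim: "(Q \<longlongrightarrow> Q t) (at t)" by (simp add: continuous_on_eq_continuous_at isCont_def)
  have hlim: "((\<lambda>s. h s / (s - t)) \<longlongrightarrow> \<sigma>') (at t)"
    using \<sigma> by (simp add: has_field_derivative_iff h_def)
  have "isCont \<sigma> t" using \<sigma> by (rule DERIV_isCont)
  then have h0: "(h \<longlongrightarrow> 0) (at t)" unfolding h_def isCont_def by (rule LIM_zero)
  \<comment> \<open>Of the two factors \<open>h s\<close> in the remainder, one is combined with
    \<open>s - t\<close> into a convergent quotient and the other tends to 0.\<close>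
  have remlim: "((\<lambda>s. (E s + h s * P s) / (s - t)) \<longlongrightarrow> 0) (at t)"
  proof (rule Lim_null_comparison)
    have "((\<lambda>s. M * \<bar>h s / (s - t)\<bar> * \<bar>h s\<bar> * Q s) \<longlongrightarrow> M * \<bar>\<sigma>'\<bar> * \<bar>0\<bar> * Q t) (at t)"
      by (intro tendsto_intros hlim h0 Qlim)
    then show "((\<lambda>s. M * \<bar>h s / (s - t)\<bar> * \<bar>h s\<bar> * Q s) \<longlongrightarrow> 0) (at t)" by simp
    have "\<forall>\<^sub>F s in at t. \<bar>h s\<bar> < 1"
      using order_tendstoD(2)[OF tendsto_rabs[OF h0], of 1] by simp
    then show "\<forall>\<^sub>F s in at t. norm ((E s + h s * P s) / (s - t)) \<le> M * \<bar>h s / (s - t)\<bar> * \<bar>h s\<bar> * Q s"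
    proof eventually_elim
      case (elim s)
      then have "\<bar>E s + h s * P s\<bar> / \<bar>s - t\<bar> \<le> M * (h s)\<^sup>2 * Q s / \<bar>s - t\<bar>"
        using rem[of s] by (intro divide_right_mono) auto
      also have "\<dots> = M * \<bar>h s / (s - t)\<bar> * \<bar>h s\<bar> * Q s"
        by (simp add: power2_eq_square abs_divide flip: abs_mult)
      finally show ?case by (simp add: abs_divide)
    qed
  qed
  have "((\<lambda>s. (E s + h s * P s) / (s - t) - (h s / (s - t)) * P s) \<longlongrightarrow> 0 - \<sigma>' * P t) (at t)"
    by (intro tendsto_intros remlim hlim Plim)
  then have "((\<lambda>s. E s / (s - t)) \<longlongrightarrow> - \<sigma>' * P t) (at t)"
    by (simp add: add_divide_distrib)
  moreover have "E t = 0" by (simp add: E_def)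
  moreover have "P t = (LINT y|lborel. a t y * K 1 (y - \<sigma> t))" using t by (simp add: P_def)
  ultimately have "(E has_real_derivative - \<sigma>' * (LINT y|lborel. a t y * K 1 (y - \<sigma> t))) (at t)"
    by (simp add: has_field_derivative_iff)
  then show ?thesis unfolding E_def .
qed

subsection \<open>The weak formulation at a fixed time\<close>

text \<open>The quantity \<open>a - a_xx\<close> tested against \<open>d 0\<close>, with both
  derivatives moved onto the test function.\<close>

definition momentum :: "(real \<Rightarrow> real) \<Rightarrow> (nat \<Rightarrow> real \<Rightarrow> real) \<Rightarrow> real" where
  "momentum a d = (LINT x|lborel. a x * (d 0 x - d 2 x))"

definition quadratic_terms ::
  "(real \<Rightarrow> real) \<Rightarrow> (real \<Rightarrow> real) \<Rightarrow> (real \<Rightarrow> real) \<Rightarrow> (real \<Rightarrow> real) \<Rightarrow>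
   (real \<Rightarrow> real) \<Rightarrow> (real \<Rightarrow> real) \<Rightarrow> real \<Rightarrow> real" where
  "quadratic_terms a ax b bx c cx x = 3/2 * (a x)\<^sup>2 + 1/2 * (ax x)\<^sup>2 + a x * (b x + c x)
     + ax x * (bx x + cx x) + 1/2 * ((b x)\<^sup>2 + (c x)\<^sup>2 - (bx x)\<^sup>2 - (cx x)\<^sup>2)"

text \<open>The part of the weak equation without time derivative, frozen at one time. It is
  symmetric under exchanging the pairs \<open>b, bx\<close> and \<open>c, cx\<close>, so all three
  equations of the system are instances.\<close>

definition flux ::
  "(real \<Rightarrow> real) \<Rightarrow> (real \<Rightarrow> real) \<Rightarrow> (real \<Rightarrow> real) \<Rightarrow> (real \<Rightarrow> real) \<Rightarrow>
   (real \<Rightarrow> real) \<Rightarrow> (real \<Rightarrow> real) \<Rightarrow> (nat \<Rightarrow> real \<Rightarrow> real) \<Rightarrow> real" where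
  "flux a ax b bx c cx d =
     (LINT x|lborel. ax x * (b x + c x) * d 2 x) - 1/2 * (LINT x|lborel. (a x)\<^sup>2 * d 3 x)
     + (LINT x|lborel. quadratic_terms a ax b bx c cx x * d 1 x)"

lemma weak_eq_alt:
  "weak_eq a ax b bx c cx D \<longleftrightarrow>
     pair a (\<lambda>t x. D 1 0 t x - D 1 2 t x) + pair (\<lambda>t x. ax t x * (b t x + c t x)) (D 0 2)
     - 1/2 * pair (\<lambda>t x. (a t x)\<^sup>2) (D 0 3)
     + pair (\<lambda>t. quadratic_terms (a t) (ax t) (b t) (bx t) (c t) (cx t)) (D 0 1) = 0"
  unfolding weak_eq_def quadratic_terms_def ..

lemma L1_curve_quadratic_terms:
  assumes "L2_curve a" "L2_curve ax" "L2_curve b" "L2_curve bx" "L2_curve c" "L2_curve cx"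
  shows "L1_curve (\<lambda>t. quadratic_terms (a t) (ax t) (b t) (bx t) (c t) (cx t))"
proof -
  have "L1_curve (\<lambda>t x. 3/2 * (a t x * a t x) + (1/2 * (ax t x * ax t x) + (a t x * b t x + (a t x * c t x
     + (ax t x * bx t x + (ax t x * cx t x + (1/2 * (b t x * b t x) + (1/2 * (c t x * c t x)
     + ((-1/2) * (bx t x * bx t x) + (-1/2) * (cx t x * cx t x))))))))))"
    by (intro L1_curve_add L1_curve_cmult L1_curve_mult assms)
  also have "(\<lambda>t x. 3/2 * (a t x * a t x) + (1/2 * (ax t x * ax t x) + (a t x * b t x + (a t x * c t x
     + (ax t x * bx t x + (ax t x * cx t x + (1/2 * (b t x * b t x) + (1/2 * (c t x * c t x)
     + ((-1/2) * (bx t x * bx t x) + (-1/2) * (cx t x * cx t x))))))))))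
     = (\<lambda>t. quadratic_terms (a t) (ax t) (b t) (bx t) (c t) (cx t))"
    by (intro ext) (simp add: quadratic_terms_def power2_eq_square algebra_simps)
  finally show ?thesis .
qed

lemma L1_curve_transport_terms:
  assumes "L2_curve ax" "L2_curve b" "L2_curve c"
  shows "L1_curve (\<lambda>t x. ax t x * (b t x + c t x))"
  using L1_curve_add[OF L1_curve_mult[OF assms(1,2)] L1_curve_mult[OF assms(1,3)]]
  by (simp add: distrib_left)

lemma L1_curve_square: "L2_curve a \<Longrightarrow> L1_curve (\<lambda>t x. (a t x)\<^sup>2)"
  using L1_curve_mult[of a a] by (simp add: power2_eq_square)

lemma L1_curve_continuous_test_seq:
  assumes "L1_curve F" "test_seq d"
  shows "continuous_on {0..} (\<lambda>t. LINT x|lborel. F t x * d k x)"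
proof -
  obtain M where M: "M > 0" "\<And>x. \<bar>d k x\<bar> \<le> M" by (rule test_seq_bounded[OF assms(2), of k], rule that)
  show ?thesis
    by (rule L1_curve_continuous[OF assms(1) smooth_seq_measurable[OF test_seq_smooth[OF assms(2)]] M(2)])
qed

text \<open>The time factor must live in \<open>{\<alpha>..\<beta>}\<close> with
  \<open>\<alpha> > 0\<close>, since test functions have compact support in the open
  half-plane.\<close>

lemma test2_product:
  assumes \<rho>: "smooth_seq \<rho>" "\<And>t. t \<notin> {\<alpha>..\<beta>} \<Longrightarrow> \<rho> 0 t = 0" "\<alpha> > 0" and \<eta>: "test_seq \<eta>"
  shows "test2 (\<lambda>i j t x. \<rho> i t * \<eta> j x)"
proof -
  obtain L where L: "L > 0" "\<And>k x. \<bar>x\<bar> > L \<Longrightarrow> \<eta> k x = 0"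
    by (rule test_seq_support[OF \<eta>], rule that)
  note s = test_seq_smooth[OF \<eta>]
  have "continuous_on UNIV (\<lambda>p::real \<times> real. \<rho> i (fst p) * \<eta> j (snd p))" for i j
    by (intro continuous_intros continuous_on_compose2[OF smooth_seq_continuous[OF \<rho>(1)]]
        continuous_on_compose2[OF smooth_seq_continuous[OF s]]) auto
  moreover have "((\<lambda>s. \<rho> i s * \<eta> j x) has_real_derivative \<rho> (Suc i) t * \<eta> j x) (at t)" for i j t x
    by (rule DERIV_cmult_right[OF smooth_seq_DERIV[OF \<rho>(1)]])
  moreover have "((\<lambda>y. \<rho> i t * \<eta> j y) has_real_derivative \<rho> i t * \<eta> (Suc j) x) (at x)" for i j t x
    by (rule DERIV_cmult[OF smooth_seq_DERIV[OF s]])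
  moreover have "compact ({\<alpha>..\<beta>} \<times> {-L..L})" by (intro compact_Times compact_Icc)
  moreover have "{\<alpha>..\<beta>} \<times> {-L..L} \<subseteq> {0<..} \<times> UNIV" using \<rho>(3) by auto
  moreover have "\<rho> 0 t * \<eta> 0 x = 0" if "(t, x) \<notin> {\<alpha>..\<beta>} \<times> {-L..L}" for t x
  proof (cases "t \<in> {\<alpha>..\<beta>}")
    case True
    then have "\<bar>x\<bar> > L" using that by (auto simp: abs_if)
    then show ?thesis using L(2) by simp
  qed (use \<rho>(2) in simp)
  ultimately show ?thesis unfolding test2_def by blast
qed

text \<open>Separation of variables. Since \<open>r\<close> vanishes at negative times, the
  half-line integral extends to the whole line and \<open>F\<close> may be frozen at time 0
  there.\<close>

lemma pair_product:
  assumes "\<And>t. t < 0 \<Longrightarrow> r t = 0"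
  shows "pair F (\<lambda>t x. r t * \<psi> x) = (LINT t|lborel. r t * (LINT x|lborel. F (max 0 t) x * \<psi> x))"
  unfolding pair_def set_lebesgue_integral_def
proof (intro Bochner_Integration.integral_cong refl)
  fix t :: real
  have "(LINT x|lborel. F t x * (r t * \<psi> x)) = r t * (LINT x|lborel. F t x * \<psi> x)"
    unfolding integral_mult_right_zero[symmetric] by (simp add: mult_ac)
  then show "indicat_real {0..} t *\<^sub>R (LINT x|lborel. F t x * (r t * \<psi> x))
      = r t * (LINT x|lborel. F (max 0 t) x * \<psi> x)"
    using assms[of t] by (cases "t < 0") (auto simp: indicator_def max_def)
qed

text \<open>For a fixed \<open>\<eta>\<close>, product test functions reduce the weak equation to a
  scalar weak equation in time, with the momentum as unknown and the flux as continuous right-hand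
  side.\<close>

lemma momentum_DERIV:
  assumes L: "L2_curve a" "L2_curve ax" "L2_curve b" "L2_curve bx" "L2_curve c" "L2_curve cx"
    and weak: "\<And>D. test2 D \<Longrightarrow> weak_eq a ax b bx c cx D" and \<eta>: "test_seq \<eta>" and t: "t > 0"
  shows "((\<lambda>t. momentum (a (max 0 t)) \<eta>) has_real_derivative
            flux (a t) (ax t) (b t) (bx t) (c t) (cx t) \<eta>) (at t)"
proof -
  define A B C where
    "A t = (LINT x|lborel. ax (max 0 t) x * (b (max 0 t) x + c (max 0 t) x) * \<eta> 2 x)" and
    "B t = (LINT x|lborel. (a (max 0 t) x)\<^sup>2 * \<eta> 3 x)" and
    "C t = (LINT x|lborel. quadratic_terms (a (max 0 t)) (ax (max 0 t)) (b (max 0 t)) (bx (max 0 t))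
              (c (max 0 t)) (cx (max 0 t)) x * \<eta> 1 x)" for t
  define g where "g t = momentum (a (max 0 t)) \<eta>" for t
  have cA: "continuous_on UNIV A" unfolding A_def
    using continuous_on_max_0[OF L1_curve_continuous_test_seq[OF L1_curve_transport_terms[OF L(2,3,5)] \<eta>, of 2]] .
  have cB: "continuous_on UNIV B" unfolding B_def
    using continuous_on_max_0[OF L1_curve_continuous_test_seq[OF L1_curve_square[OF L(1)] \<eta>, of 3]] .
  have cC: "continuous_on UNIV C" unfolding C_def
    using continuous_on_max_0[OF L1_curve_continuous_test_seq[OF L1_curve_quadratic_terms[OF L] \<eta>, of 1]] .
  have cg: "continuous_on UNIV g" unfolding g_def momentum_def
    using continuous_on_max_0[OF L2_curve_continuous[OF L(1) L2_diff[OF L2_test_seq[OF \<eta>, of 0] L2_test_seq[OF \<eta>, of 2]]]] .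
  have "(g has_real_derivative A t - 1/2 * B t + C t) (at t)"
  proof (rule DERIV_if_weak_deriv[OF cg _ t])
    show "continuous_on UNIV (\<lambda>t. A t - 1/2 * B t + C t)"
      by (intro continuous_intros cA cB cC)
    fix \<rho> \<alpha> \<beta> assume \<rho>: "smooth_seq \<rho>" "\<alpha> > 0" "\<And>x. x \<notin> {\<alpha>..\<beta>} \<Longrightarrow> \<rho> 0 x = (0::real)"
    have neg: "\<rho> k s = 0" if "s < 0" for s k
      by (rule smooth_seq_vanishing[OF \<rho>(1), of "{..<0}"]) (use \<rho>(2,3) that in auto)
    have pp: "pair F (\<lambda>t x. \<rho> k t * \<psi> x) = (LINT t|lborel. \<rho> k t * (LINT x|lborel. F (max 0 t) x * \<psi> x))"
      for F \<psi> k by (rule pair_product) (rule neg)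
    have "open (- {\<alpha>..\<beta>})" by (rule open_Compl[OF closed_atLeastAtMost])
    have out: "\<rho> k s = 0" if "s \<notin> {\<alpha>..\<beta>}" for s k
      by (rule smooth_seq_vanishing[OF \<rho>(1) \<open>open (- {\<alpha>..\<beta>})\<close>]) (use \<rho>(3) that in auto)
    have int: "integrable lborel (\<lambda>t. \<rho> k t * G t)" if "continuous_on UNIV G" for G k
      by (rule integrable_continuous_vanishing[where a=\<alpha> and b=\<beta>])
         (use out that smooth_seq_continuous[OF \<rho>(1)] in \<open>auto intro!: continuous_on_mult\<close>)
    have "weak_eq a ax b bx c cx (\<lambda>i j t x. \<rho> i t * \<eta> j x)"
      by (rule weak[OF test2_product[OF \<rho>(1) _ \<rho>(2) \<eta>]]) (rule \<rho>(3))
    then have "pair a (\<lambda>t x. \<rho> 1 t * (\<eta> 0 x - \<eta> 2 x))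
        + pair (\<lambda>t x. ax t x * (b t x + c t x)) (\<lambda>t x. \<rho> 0 t * \<eta> 2 x)
        - 1/2 * pair (\<lambda>t x. (a t x)\<^sup>2) (\<lambda>t x. \<rho> 0 t * \<eta> 3 x)
        + pair (\<lambda>t. quadratic_terms (a t) (ax t) (b t) (bx t) (c t) (cx t)) (\<lambda>t x. \<rho> 0 t * \<eta> 1 x) = 0"
      unfolding weak_eq_alt right_diff_distrib .
    then have "(LINT t|lborel. \<rho> 1 t * g t) + (LINT t|lborel. \<rho> 0 t * A t)
        - 1/2 * (LINT t|lborel. \<rho> 0 t * B t) + (LINT t|lborel. \<rho> 0 t * C t) = 0"
      unfolding pp A_def B_def C_def g_def momentum_def .
    moreover have "(LINT t|lborel. \<rho> 0 t * (A t - 1/2 * B t + C t)) = (LINT t|lborel. \<rho> 0 t * A t)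
        - 1/2 * (LINT t|lborel. \<rho> 0 t * B t) + (LINT t|lborel. \<rho> 0 t * C t)"
    proof -
      have "(LINT t|lborel. \<rho> 0 t * (A t - 1/2 * B t + C t))
          = (LINT t|lborel. \<rho> 0 t * A t - 1/2 * (\<rho> 0 t * B t) + \<rho> 0 t * C t)"
        by (simp add: algebra_simps)
      then show ?thesis using int[OF cA, of 0] int[OF cB, of 0] int[OF cC, of 0] by simp
    qed
    ultimately show "(LINT t|lborel. \<rho> 1 t * g t) + (LINT t|lborel. \<rho> 0 t * (A t - 1/2 * B t + C t)) = 0"
      by simp
  qed
  moreover have "A t - 1/2 * B t + C t = flux (a t) (ax t) (b t) (bx t) (c t) (cx t) \<eta>"
    using t by (simp add: A_def B_def C_def flux_def)
  ultimately show ?thesis by (simp add: g_def[abs_def])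
qed

subsection \<open>The stationary identity\<close>

text \<open>A parity count. The odd coefficient \<open>ax * (b + c)\<close> meets the second
  derivative, which keeps its sign under reflection; the even coefficients meet derivatives of order
  1 and 3, which change sign. Every term is therefore reversed.\<close>

lemma flux_reflect:
  assumes m: "a \<in> borel_measurable borel" "ax \<in> borel_measurable borel" "b \<in> borel_measurable borel"
      "bx \<in> borel_measurable borel" "c \<in> borel_measurable borel" "cx \<in> borel_measurable borel"
    and \<eta>: "smooth_seq \<eta>"
    and even: "AE x in lborel. a x = a (p - x)" "AE x in lborel. b x = b (p - x)" "AE x in lborel. c x = c (p - x)"
    and odd: "AE x in lborel. ax x = - ax (p - x)" "AE x in lborel. bx x = - bx (p - x)"
      "AE x in lborel. cx x = - cx (p - x)"
  shows "flux a ax b bx c cx (\<lambda>k x. (-1) ^ k * \<eta> k (p - x)) = - flux a ax b bx c cx \<eta>"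
proof -
  note [measurable] = m smooth_seq_measurable[OF \<eta>]
  have [measurable]: "quadratic_terms a ax b bx c cx \<in> borel_measurable borel"
    unfolding quadratic_terms_def by measurable
  have reflect: "(LINT x|lborel. F x * \<psi> (p - x)) = s * (LINT x|lborel. F x * \<psi> x)"
    if [measurable]: "F \<in> borel_measurable borel" "\<psi> \<in> borel_measurable borel"
      and F: "AE x in lborel. F (p - x) = s * F x" for F \<psi> :: "real \<Rightarrow> real" and s
  proof -
    have "(LINT x|lborel. F x * \<psi> (p - x)) = (LINT x|lborel. F (p - x) * \<psi> x)"
      using integral_reflect[of "\<lambda>x. F x * \<psi> (p - x)" p] by simp
    also have "\<dots> = (LINT x|lborel. s * (F x * \<psi> x))"
      using F by (intro integral_cong_AE) (auto elim: eventually_mono)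
    finally show ?thesis by simp
  qed
  have 1: "AE x in lborel. ax (p - x) * (b (p - x) + c (p - x)) = -1 * (ax x * (b x + c x))"
    using even odd by eventually_elim (simp add: algebra_simps)
  have 2: "AE x in lborel. (a (p - x))\<^sup>2 = 1 * (a x)\<^sup>2"
    using even by eventually_elim simp
  have 3: "AE x in lborel. quadratic_terms a ax b bx c cx (p - x) = 1 * quadratic_terms a ax b bx c cx x"
    using even odd unfolding quadratic_terms_def
    by eventually_elim (simp add: algebra_simps)
  show ?thesis
    unfolding flux_def
    using reflect[OF _ _ 1, of "\<eta> 2"] reflect[OF _ _ 2, of "\<eta> 3"] reflect[OF _ _ 3, of "\<eta> 1"]
    by (simp add: power2_eq_square power3_eq_cube algebra_simps)
qed

text \<open>The function \<open>\<tau>\<close> is the reflection of \<open>\<eta>\<close> in the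
  fixed point \<open>\<beta> t\<close>. By the symmetry at time \<open>s\<close>, pairing with
  \<open>\<eta>\<close> equals pairing with the reflection in \<open>\<beta> s\<close>. The
  difference of the pairings with \<open>\<eta>\<close> and \<open>\<tau>\<close> is thus of the
  moving form already treated, and its two derivatives are equated.\<close>

lemma flux_eq_momentum:
  assumes L: "L2_curve a" "L2_curve ax" "L2_curve b" "L2_curve bx" "L2_curve c" "L2_curve cx"
    and weak: "\<And>D. test2 D \<Longrightarrow> weak_eq a ax b bx c cx D" and \<eta>: "test_seq \<eta>" and t: "t > 0"
    and w: "weak_deriv (a t) (ax t)" "weak_deriv (b t) (bx t)" "weak_deriv (c t) (cx t)"
    and sym: "\<And>s. s \<ge> 0 \<Longrightarrow> AE x in lborel. a s x = a s (2 * \<beta> s - x)"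
      "AE x in lborel. b t x = b t (2 * \<beta> t - x)" "AE x in lborel. c t x = c t (2 * \<beta> t - x)"
    and \<beta>: "(\<beta> has_real_derivative \<beta>') (at t)"
  shows "flux (a t) (ax t) (b t) (bx t) (c t) (cx t) \<eta> = \<beta>' * momentum (a t) (\<lambda>k. \<eta> (Suc k))"
proof -
  let ?R = "flux (a t) (ax t) (b t) (bx t) (c t) (cx t)"
  have L2: "L2 (a s)" "L2 (ax s)" "L2 (b s)" "L2 (bx s)" "L2 (c s)" "L2 (cx s)" if "s \<ge> 0" for s
    using L that by (auto simp: L2_curve_def)
  define p where "p = 2 * \<beta> t"
  define \<tau> where "\<tau> k x = (-1) ^ k * \<eta> k (p - x)" for k x
  have \<tau>: "test_seq \<tau>" unfolding \<tau>_def using test_seq_affine[OF \<eta>, of "-1" p] by simp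
  \<comment> \<open>Reflecting once at the origin turns the moving reflection into a moving
    translation: \<open>\<eta> 0 (2 * \<beta> s - y)\<close> is
    \<open>\<eta>' 0 (y - 2 * \<beta> s)\<close>. The sequence \<open>K\<close> is one minus the
    second derivative, applied to \<open>\<eta>'\<close>.\<close>
  define \<eta>' where "\<eta>' k x = (-1) ^ k * \<eta> k (- x)" for k x
  have \<eta>': "test_seq \<eta>'" unfolding \<eta>'_def using test_seq_affine[OF \<eta>, of "-1" 0] by simp
  define K where "K k x = \<eta>' k x - \<eta>' (Suc (Suc k)) x" for k x
  have K: "test_seq K" unfolding K_def
    by (intro test_seq_diff test_seq_Suc[OF test_seq_Suc[OF \<eta>']] \<eta>')
  have K0: "K 0 x = \<eta> 0 (- x) - \<eta> 2 (- x)" for x by (simp add: K_def \<eta>'_def numeral_2_eq_2)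
  have K1: "K 1 x = - (\<eta> 1 (- x) - \<eta> 3 (- x))" for x by (simp add: K_def \<eta>'_def numeral_3_eq_3)
  have [measurable]: "\<eta> k \<in> borel_measurable borel" for k
    by (rule smooth_seq_measurable[OF test_seq_smooth[OF \<eta>]])
  have LK: "L2 (\<lambda>y. K 0 (y - q))" for q
    using L2_affine[OF L2_test_seq[OF K], of 1 0 "-q"] by simp
  have m\<eta>: "momentum (a s) \<eta> = (LINT y|lborel. a s y * K 0 (y - 2 * \<beta> s))" if s: "s \<ge> 0" for s
  proof -
    have [measurable]: "a s \<in> borel_measurable borel" using L2[OF s] by (simp add: L2_def)
    have "momentum (a s) \<eta> = (LINT x|lborel. a s (2 * \<beta> s - x) * (\<eta> 0 x - \<eta> 2 x))"
      unfolding momentum_def using sym(1)[OF s] by (intro integral_cong_AE) (auto elim: eventually_mono)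
    also have "\<dots> = (LINT y|lborel. a s y * (\<eta> 0 (2 * \<beta> s - y) - \<eta> 2 (2 * \<beta> s - y)))"
      using integral_reflect[of "\<lambda>x. a s (2 * \<beta> s - x) * (\<eta> 0 x - \<eta> 2 x)" "2 * \<beta> s"] by simp
    finally show ?thesis by (simp add: K0)
  qed
  have m\<tau>: "momentum (a s) \<tau> = (LINT y|lborel. a s y * K 0 (y - p))" for s
    by (simp add: momentum_def \<tau>_def K0)
  have d\<eta>: "((\<lambda>s. momentum (a (max 0 s)) \<eta>) has_real_derivative ?R \<eta>) (at t)"
    by (rule momentum_DERIV[OF L weak \<eta> t])
  have d\<tau>: "((\<lambda>s. momentum (a (max 0 s)) \<tau>) has_real_derivative ?R \<tau>) (at t)"
    by (rule momentum_DERIV[OF L weak \<tau> t])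
  have "((\<lambda>s. momentum (a (max 0 s)) \<eta> - momentum (a (max 0 s)) \<tau>) has_real_derivative ?R \<eta> - ?R \<tau>) (at t)"
    by (rule DERIV_diff[OF d\<eta> d\<tau>])
  then have 1: "((\<lambda>s. LINT y|lborel. a (max 0 s) y * (K 0 (y - 2 * \<beta> s) - K 0 (y - 2 * \<beta> t)))
      has_real_derivative ?R \<eta> - ?R \<tau>) (at t)"
  proof (rule has_field_derivative_transform_within_open[of _ _ _ "{0<..}"])
    fix s :: real assume "s \<in> {0<..}"
    then have s: "s \<ge> 0" by simp
    then show "momentum (a (max 0 s)) \<eta> - momentum (a (max 0 s)) \<tau>
        = (LINT y|lborel. a (max 0 s) y * (K 0 (y - 2 * \<beta> s) - K 0 (y - 2 * \<beta> t)))"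
      using m\<eta>[OF s] m\<tau>[of s] L2_mult_integrable[OF L2(1)[OF s] LK]
      by (simp add: right_diff_distrib p_def)
  qed (use t in auto)
  have "((\<lambda>s. 2 * \<beta> s) has_real_derivative 2 * \<beta>') (at t)" by (rule DERIV_cmult[OF \<beta>])
  from DERIV_moving_test_function[OF L(1) K this t]
  have 2: "((\<lambda>s. LINT y|lborel. a (max 0 s) y * (K 0 (y - 2 * \<beta> s) - K 0 (y - 2 * \<beta> t)))
      has_real_derivative - (2 * \<beta>') * (LINT y|lborel. a t y * K 1 (y - 2 * \<beta> t))) (at t)" .
  \<comment> \<open>The minus sign is the chain rule for the reflection; the symmetry at time
    \<open>t\<close> then undoes the reflection of the argument.\<close>
  have mS: "(LINT y|lborel. a t y * K 1 (y - 2 * \<beta> t)) = - momentum (a t) (\<lambda>k. \<eta> (Suc k))"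
  proof -
    have t0: "t \<ge> 0" using t by simp
    have [measurable]: "a t \<in> borel_measurable borel" using L2[OF t0] by (simp add: L2_def)
    have "(LINT y|lborel. a t y * K 1 (y - 2 * \<beta> t))
        = - (LINT y|lborel. a t y * (\<eta> 1 (2 * \<beta> t - y) - \<eta> 3 (2 * \<beta> t - y)))"
      unfolding K1 integral_minus[symmetric]
      by (intro Bochner_Integration.integral_cong) (auto simp: algebra_simps)
    also have "(LINT y|lborel. a t y * (\<eta> 1 (2 * \<beta> t - y) - \<eta> 3 (2 * \<beta> t - y)))
        = (LINT x|lborel. a t (2 * \<beta> t - x) * (\<eta> 1 x - \<eta> 3 x))"
      using integral_reflect[of "\<lambda>x. a t (2 * \<beta> t - x) * (\<eta> 1 x - \<eta> 3 x)" "2 * \<beta> t"] by simp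
    also have "\<dots> = (LINT x|lborel. a t x * (\<eta> 1 x - \<eta> 3 x))"
      using sym(1)[OF t0] by (intro integral_cong_AE) (auto elim: eventually_mono)
    finally show ?thesis by (simp add: momentum_def numeral_3_eq_3)
  qed
  \<comment> \<open>Uniqueness of derivatives. The factor 2 on the right comes from the shift by
    \<open>2 * \<beta>\<close> and cancels against the doubling of the flux on the left.\<close>
  have "?R \<eta> - ?R \<tau> = 2 * \<beta>' * momentum (a t) (\<lambda>k. \<eta> (Suc k))"
    using DERIV_unique[OF 1 2] mS by simp
  moreover have "?R \<tau> = - ?R \<eta>"
    unfolding \<tau>_def
  proof (rule flux_reflect)
    have t0: "t \<ge> 0" using t by simp
    note L2t = L2[OF t0]
    show "AE x in lborel. a t x = a t (p - x)" "AE x in lborel. b t x = b t (p - x)"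
      "AE x in lborel. c t x = c t (p - x)" using sym(1)[OF t0] sym(2,3) by (simp_all add: p_def)
    then show "AE x in lborel. ax t x = - ax t (p - x)" "AE x in lborel. bx t x = - bx t (p - x)"
      "AE x in lborel. cx t x = - cx t (p - x)"
      using weak_deriv_of_even_is_odd L2t w by blast+
  qed (use L2[of t] t test_seq_smooth[OF \<eta>] in \<open>auto simp: L2_def\<close>)
  ultimately show ?thesis by simp
qed

subsection \<open>Travelling waves\<close>

lemma test2_DERIV:
  assumes "test2 D"
  shows "((\<lambda>s. D i j s x) has_real_derivative D (Suc i) j t x) (at t)"
    "((\<lambda>y. D i j t y) has_real_derivative D i (Suc j) t x) (at x)"
    "continuous_on UNIV (\<lambda>p. D i j (fst p) (snd p))"
  using assms unfolding test2_def by auto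

text \<open>Only \<open>D 0 0\<close> is assumed to vanish off \<open>K\<close>. As the complement
  of \<open>K\<close> has open sections in both directions, the time derivatives vanish there as
  well, and after them the space derivatives.\<close>

lemma test2_support:
  assumes D: "test2 D"
  obtains B where "B > 0" "\<And>i j t x. t \<le> 0 \<or> t > B \<or> \<bar>x\<bar> > B \<Longrightarrow> D i j t x = 0"
proof -
  obtain K where K: "compact K" "K \<subseteq> {0<..} \<times> UNIV" "\<And>t x. (t, x) \<notin> K \<Longrightarrow> D 0 0 t x = 0"
    using D unfolding test2_def by auto
  have oK: "open (- K)" using K(1) by (simp add: compact_imp_closed open_Compl)
  have sect: "open {s. (s, x) \<notin> K}" "open {y. (t, y) \<notin> K}" for t x :: real
    using continuous_open_vimage[OF oK, of "\<lambda>s. (s, x)"] continuous_open_vimage[OF oK, of "\<lambda>y. (t, y)"]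
    by (auto simp: vimage_def intro!: continuous_intros)
  have 0: "D i 0 t x = 0" if "(t, x) \<notin> K" for i t x
    using that
  proof (induction i arbitrary: t)
    case (Suc i)
    show ?case
      by (rule DERIV_eq_0_if_vanishing[OF test2_DERIV(1)[OF D] sect(1)[of x]]) (use Suc in auto)
  qed (rule K(3))
  have z: "D i j t x = 0" if "(t, x) \<notin> K" for i j t x
    using that
  proof (induction j arbitrary: x)
    case (Suc j)
    show ?case
      by (rule DERIV_eq_0_if_vanishing[OF test2_DERIV(2)[OF D] sect(2)[of t]]) (use Suc in auto)
  qed (rule 0)
  obtain B where B: "\<And>p. p \<in> K \<Longrightarrow> norm p \<le> B"
    using compact_imp_bounded[OF K(1)] by (auto simp: bounded_iff)
  show ?thesis
  proof (rule that[of "max B 1"])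
    fix i j t x assume *: "t \<le> 0 \<or> t > max B 1 \<or> \<bar>x\<bar> > max B 1"
    have "(t, x) \<notin> K"
    proof
      assume "(t, x) \<in> K"
      then have "norm (t, x) \<le> B" "t > 0" using B K(2) by auto
      moreover have "norm t \<le> norm (t, x)" "norm x \<le> norm (t, x)"
        using norm_fst_le[of t x] norm_snd_le[of x t] by auto
      ultimately show False using * by auto
    qed
    then show "D i j t x = 0" by (rule z)
  qed simp
qed

lemma test2_bounded:
  assumes D: "test2 D"
  obtains M where "M > 0" "\<And>t x. \<bar>D i j t x\<bar> \<le> M"
proof -
  obtain B where B: "B > 0" "\<And>i j t x. t \<le> 0 \<or> t > B \<or> \<bar>x\<bar> > B \<Longrightarrow> D i j t x = 0"
    by (rule test2_support[OF D], rule that)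
  let ?S = "(\<lambda>p. D i j (fst p) (snd p)) ` ({0..B} \<times> {-B..B})"
  have "compact ?S"
    by (rule compact_continuous_image[OF continuous_on_subset[OF test2_DERIV(3)[OF D]]])
       (auto intro!: compact_Times)
  then obtain M where M: "\<forall>y\<in>?S. norm y \<le> M"
    using compact_imp_bounded[of ?S] unfolding bounded_iff by blast
  have "\<bar>D i j t x\<bar> \<le> max M 1" for t x
  proof (cases "t \<le> 0 \<or> t > B \<or> \<bar>x\<bar> > B")
    case False
    then have "(t, x) \<in> {0..B} \<times> {-B..B}" by auto
    then have "D i j t x \<in> ?S" by force
    with M have "norm (D i j t x) \<le> M" by blast
    then show ?thesis by simp
  qed (use B(2) in simp)
  then show ?thesis using that[of "max M 1"] by simp
qed

lemma DERIV_along_line: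
  fixes f ft fx :: "real \<Rightarrow> real \<Rightarrow> real"
  assumes ft: "\<And>t x. ((\<lambda>s. f s x) has_real_derivative ft t x) (at t)"
    and fx: "\<And>t x. ((\<lambda>y. f t y) has_real_derivative fx t x) (at x)"
    and cont: "continuous_on UNIV (\<lambda>p. ft (fst p) (snd p))"
  shows "((\<lambda>t. f t (y + \<kappa> * (t - t0))) has_real_derivative
            ft t (y + \<kappa> * (t - t0)) + \<kappa> * fx t (y + \<kappa> * (t - t0))) (at t)"
proof -
  define z where "z s = y + \<kappa> * (s - t0)" for s
  define E where "E s = f s (z s) - f t (z s)" for s
  have "(z has_real_derivative \<kappa>) (at t)"
    unfolding z_def by (auto intro!: derivative_eq_intros)
  from DERIV_chain2[OF fx[of t "z t"] this]
  have G: "((\<lambda>s. f t (z s)) has_real_derivative fx t (z t) * \<kappa>) (at t)" .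
  have "((\<lambda>s. E s / (s - t)) \<longlongrightarrow> ft t (z t)) (at t)"
  proof (rule tendstoI)
    fix e :: real assume "e > 0"
    have "isCont (\<lambda>p. ft (fst p) (snd p)) (t, z t)"
      using cont by (simp add: continuous_on_eq_continuous_at)
    then obtain \<delta> where \<delta>: "\<delta> > 0"
      "\<And>p. dist p (t, z t) < \<delta> \<Longrightarrow> dist (ft (fst p) (snd p)) (ft t (z t)) < e / 2"
      using \<open>e > 0\<close> unfolding continuous_at_eps_delta by (metis fst_conv half_gt_zero snd_conv)
    \<comment> \<open>The points \<open>(r, z s)\<close> with \<open>r\<close> between
      \<open>t\<close> and \<open>s\<close> are within
      \<open>(1 + \<bar>\<kappa>\<bar>) * \<bar>s - t\<bar>\<close> of \<open>(t, z t)\<close>,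
      which dictates this radius.\<close>
    have "\<forall>\<^sub>F s in at t. dist s t < \<delta> / (1 + \<bar>\<kappa>\<bar>) \<and> s \<noteq> t"
      unfolding eventually_at using \<delta>(1) by (intro exI[of _ "\<delta> / (1 + \<bar>\<kappa>\<bar>)"]) auto
    then show "\<forall>\<^sub>F s in at t. dist (E s / (s - t)) (ft t (z t)) < e"
    proof eventually_elim
      case (elim s)
      then have st: "\<bar>s - t\<bar> * (1 + \<bar>\<kappa>\<bar>) < \<delta>" "s \<noteq> t" by (auto simp: dist_real_def field_simps)
      have near: "norm (ft r (z s) - ft t (z t)) \<le> e / 2" if "r \<in> closed_segment t s" for r
      proof -
        have "\<bar>r - t\<bar> \<le> \<bar>s - t\<bar>" using that by (auto simp: closed_segment_eq_real_ivl split: if_splits)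
        moreover have "\<bar>z s - z t\<bar> = \<bar>\<kappa>\<bar> * \<bar>s - t\<bar>" by (simp add: z_def flip: abs_mult right_diff_distrib)
        moreover have "dist (r, z s) (t, z t) \<le> \<bar>r - t\<bar> + \<bar>z s - z t\<bar>"
          unfolding dist_Pair_Pair dist_real_def by (rule order_trans[OF sqrt_sum_squares_le_sum_abs]) simp
        ultimately have "dist (r, z s) (t, z t) < \<delta>" using st(1) by (simp add: algebra_simps)
        from \<delta>(2)[OF this] show ?thesis by (simp add: dist_real_def)
      qed
      have "norm ((f s (z s) - ft t (z t) * s) - (f t (z s) - ft t (z t) * t)) \<le> e / 2 * norm (s - t)"
      proof (rule field_differentiable_bound[where S="closed_segment t s" and f'="\<lambda>r. ft r (z s) - ft t (z t)"])
        show "((\<lambda>r. f r (z s) - ft t (z t) * r) has_field_derivative ft r (z s) - ft t (z t))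
            (at r within closed_segment t s)" for r
          using has_field_derivative_at_within[OF DERIV_diff[OF ft[of "z s" r] DERIV_cmult_Id]] by simp
      qed (use near in auto)
      then have "\<bar>E s - ft t (z t) * (s - t)\<bar> \<le> e / 2 * \<bar>s - t\<bar>"
        by (simp add: E_def algebra_simps)
      then have "\<bar>(E s - ft t (z t) * (s - t)) / (s - t)\<bar> \<le> e / 2"
        using st(2) by (simp add: abs_divide divide_le_eq)
      moreover have "(E s - ft t (z t) * (s - t)) / (s - t) = E s / (s - t) - ft t (z t)"
        using st(2) by (simp add: diff_divide_distrib)
      ultimately show ?case using \<open>e > 0\<close> by (simp add: dist_real_def)
    qed
  qed
  then have "(E has_real_derivative ft t (z t)) (at t)"
    by (simp add: has_field_derivative_iff E_def)
  from DERIV_add[OF this G] show ?thesis by (simp add: E_def z_def mult.commute)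
qed

text \<open>The majorant is \<open>M * \<bar>F y\<bar>\<close> on the strip of times
  \<open>{0..B}\<close>; this integrability licenses the later exchange of the two
  integrals.\<close>

lemma integrable_product_bound:
  fixes F :: "real \<Rightarrow> real" and \<psi> :: "real \<times> real \<Rightarrow> real"
  assumes F: "integrable lborel F" and \<psi>: "continuous_on UNIV \<psi>"
    and M: "\<And>p. \<bar>\<psi> p\<bar> \<le> M" and van: "\<And>t y. t \<notin> {0..B} \<Longrightarrow> \<psi> (t, y) = 0"
  shows "integrable (lborel \<Otimes>\<^sub>M lborel) (\<lambda>(t, y). F y * \<psi> (t, y))"
proof -
  have [measurable]: "F \<in> borel_measurable borel" using borel_measurable_integrable[OF F] by simp
  have [measurable]: "\<psi> \<in> borel_measurable (borel \<Otimes>\<^sub>M borel)"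
    unfolding borel_prod by (rule borel_measurable_continuous_onI[OF \<psi>])
  let ?G = "\<lambda>(t, y). indicator {0..B} t * \<bar>F y\<bar> :: real"
  have "integrable (lborel \<Otimes>\<^sub>M lborel) ?G"
  proof (rule lborel_pair.Fubini_integrable)
    show "integrable lborel (\<lambda>t. LINT y|lborel. norm (?G (t, y)))"
      by (simp add: abs_mult emeasure_lborel_Icc_eq)
  qed (use F in auto)
  then have "integrable (lborel \<Otimes>\<^sub>M lborel) (\<lambda>p. M * ?G p)" by (rule integrable_mult_right)
  then show ?thesis
  proof (rule Bochner_Integration.integrable_bound)
    show "(\<lambda>(t, y). F y * \<psi> (t, y)) \<in> borel_measurable (lborel \<Otimes>\<^sub>M lborel)" by measurable
    show "AE p in lborel \<Otimes>\<^sub>M lborel. norm (case p of (t, y) \<Rightarrow> F y * \<psi> (t, y)) \<le> norm (M * ?G p)"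
    proof (rule AE_I2)
      fix p :: "real \<times> real"
      obtain t y where p: "p = (t, y)" by (cases p)
      have "norm (F y * \<psi> (t, y)) \<le> norm (M * ?G (t, y))"
        using van[of t y] mult_right_mono[OF order_trans[OF M[of "(t, y)"] abs_ge_self], of "\<bar>F y\<bar>"]
        by (cases "t \<in> {0..B}") (auto simp: abs_mult mult.commute)
      then show "norm (case p of (t, y) \<Rightarrow> F y * \<psi> (t, y)) \<le> norm (M * ?G p)" by (simp add: p)
    qed
  qed
qed

text \<open>After the substitution \<open>y = x - \<kappa> (t - t0)\<close> the two derivatives combine to the total time
  derivative of a compactly supported function, whose integral over time vanishes.\<close>

lemma travelling_weak_eq:
  assumes L: "L2 a" "L2 ax" "L2 b" "L2 bx" "L2 c" "L2 cx"
    and stat: "\<And>\<eta>. test_seq \<eta> \<Longrightarrow> flux a ax b bx c cx \<eta> = \<kappa> * momentum a (\<lambda>k. \<eta> (Suc k))"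
    and D: "test2 D"
  shows "weak_eq (\<lambda>t x. a (x - \<kappa> * (t - t0))) (\<lambda>t x. ax (x - \<kappa> * (t - t0)))
    (\<lambda>t x. b (x - \<kappa> * (t - t0))) (\<lambda>t x. bx (x - \<kappa> * (t - t0)))
    (\<lambda>t x. c (x - \<kappa> * (t - t0))) (\<lambda>t x. cx (x - \<kappa> * (t - t0))) D"
proof -
  obtain B where B: "B > 0" "\<And>i j t x. t \<le> 0 \<or> t > B \<or> \<bar>x\<bar> > B \<Longrightarrow> D i j t x = 0"
    by (rule test2_support[OF D], rule that)
  define \<Phi> where "\<Phi> i j t y = D i j t (y + \<kappa> * (t - t0))" for i j t y
  \<comment> \<open>For times in the support the shift is at most
    \<open>\<bar>\<kappa>\<bar> * (B + \<bar>t0\<bar>)\<close>, so \<open>R\<close> bounds the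
    support in the moving coordinate uniformly in time.\<close>
  define R where "R = B + \<bar>\<kappa>\<bar> * (B + \<bar>t0\<bar>)"
  have \<Phi>0: "\<Phi> i j t y = 0" if "t \<le> 0 \<or> t > B \<or> \<bar>y\<bar> > R" for i j t y
  proof (cases "t \<le> 0 \<or> t > B")
    case False
    then have "\<bar>\<kappa>\<bar> * \<bar>t - t0\<bar> \<le> \<bar>\<kappa>\<bar> * (B + \<bar>t0\<bar>)" by (intro mult_left_mono) auto
    then have "\<bar>\<kappa> * (t - t0)\<bar> \<le> \<bar>\<kappa>\<bar> * (B + \<bar>t0\<bar>)" by (simp add: abs_mult)
    moreover have "\<bar>y\<bar> > R" using that False by simp
    ultimately have "\<bar>y + \<kappa> * (t - t0)\<bar> > B" unfolding R_def by linarith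
    then show ?thesis unfolding \<Phi>_def by (intro B(2)) simp
  qed (use B(2) in \<open>auto simp: \<Phi>_def\<close>)
  have \<Phi>cont: "continuous_on UNIV (\<lambda>p. \<Phi> i j (fst p) (snd p))" for i j
  proof -
    have "continuous_on UNIV (\<lambda>p::real \<times> real. (fst p, snd p + \<kappa> * (fst p - t0)))"
      by (intro continuous_intros)
    from continuous_on_compose2[OF test2_DERIV(3)[OF D, of i j] this] show ?thesis
      by (simp add: \<Phi>_def)
  qed
  have \<Phi>test: "test_seq (\<lambda>j. \<Phi> 0 j t)" for t
  proof (rule test_seqI)
    show "smooth_seq (\<lambda>j. \<Phi> 0 j t)" unfolding smooth_seq_def
    proof (intro allI)
      fix k x
      have "((\<lambda>y. y + \<kappa> * (t - t0)) has_real_derivative 1) (at x)"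
        by (auto intro!: derivative_eq_intros)
      from DERIV_chain2[OF test2_DERIV(2)[OF D, of 0 k t "x + \<kappa> * (t - t0)"] this]
      show "(\<Phi> 0 k t has_real_derivative \<Phi> 0 (Suc k) t x) (at x)" by (simp add: \<Phi>_def[abs_def])
    qed
    show "\<Phi> 0 0 t x = 0" if "\<bar>x\<bar> > R" for x using \<Phi>0 that by simp
  qed
  have int2: "integrable (lborel \<Otimes>\<^sub>M lborel) (\<lambda>(t, y). F y * \<Phi> i j t y)"
    if "integrable lborel F" for F :: "real \<Rightarrow> real" and i j
  proof -
    obtain M where M: "M > 0" "\<And>t x. \<bar>D i j t x\<bar> \<le> M" by (rule test2_bounded[OF D, of i j], rule that)
    have "integrable (lborel \<Otimes>\<^sub>M lborel) (\<lambda>(t, y). F y * (\<lambda>p. \<Phi> i j (fst p) (snd p)) (t, y))"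
      by (rule integrable_product_bound[OF that \<Phi>cont, where M=M and B=B])
         (use M(2) \<Phi>0 in \<open>auto simp: \<Phi>_def\<close>)
    then show ?thesis by simp
  qed
  have int1: "integrable lborel (\<lambda>t. LINT y|lborel. F y * \<Phi> i j t y)"
    if "integrable lborel F" for F :: "real \<Rightarrow> real" and i j
    using lborel_pair.integrable_fst'[OF int2[OF that, of i j]] by simp
  have shift: "(LINT x|lborel. F (x - \<kappa> * (t - t0)) * \<psi> x) = (LINT y|lborel. F y * \<psi> (y + \<kappa> * (t - t0)))"
    for F \<psi> :: "real \<Rightarrow> real" and t
    using integral_shift[of "\<lambda>x. F (x - \<kappa> * (t - t0)) * \<psi> x" "\<kappa> * (t - t0)"] by simp
  have pairD: "pair (\<lambda>t x. F (x - \<kappa> * (t - t0))) (D i j) = (LINT t|lborel. LINT y|lborel. F y * \<Phi> i j t y)"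
    for F :: "real \<Rightarrow> real" and i j
    unfolding pair_def set_lebesgue_integral_def shift
    using \<Phi>0 by (intro Bochner_Integration.integral_cong) (auto simp: indicator_def \<Phi>_def)
  \<comment> \<open>An L2 function need not be integrable on the line. Cutting \<open>a\<close> off
    outside \<open>{-R..R}\<close> makes it so, without changing any product with
    \<open>\<Phi>\<close>.\<close>
  define a' where "a' y = a y * indicator {-R..R} y" for y
  have a'int: "integrable lborel a'" unfolding a'_def by (rule L2_mult_integrable[OF L(1) L2_indicator])
  have a'\<Phi>: "a y * \<Phi> i j t y = a' y * \<Phi> i j t y" for i j t y
  proof (cases "\<bar>y\<bar> \<le> R")
    case True
    then show ?thesis by (simp add: a'_def abs_le_iff)
  qed (use \<Phi>0 in simp)
  define S where "S i j t = (LINT y|lborel. a' y * \<Phi> i j t y)" for i j t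
  have Sint: "integrable lborel (S i j)" for i j unfolding S_def[abs_def] by (rule int1[OF a'int])
  have a'\<Phi>int: "integrable lborel (\<lambda>y. a' y * \<Phi> i j t y)" for i j t
  proof -
    obtain M where M: "M > 0" "\<And>t x. \<bar>D i j t x\<bar> \<le> M" by (rule test2_bounded[OF D, of i j], rule that)
    have "continuous_on UNIV (\<lambda>y::real. (t, y))" by (intro continuous_intros)
    from continuous_on_compose2[OF \<Phi>cont[of i j] this]
    have "continuous_on UNIV (\<lambda>y. \<Phi> i j t y)" by simp
    from integrable_mult_bounded[OF a'int borel_measurable_continuous_onI[OF this], of M] M(2)
    show ?thesis by (simp add: \<Phi>_def)
  qed
  have p1: "pair (\<lambda>t x. a (x - \<kappa> * (t - t0))) (\<lambda>t x. D 1 0 t x - D 1 2 t x) = (LINT t|lborel. S 1 0 t - S 1 2 t)"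
  proof -
    have "(LINT x|lborel. a (x - \<kappa> * (t - t0)) * (D 1 0 t x - D 1 2 t x)) = S 1 0 t - S 1 2 t" for t
    proof -
      have "(LINT x|lborel. a (x - \<kappa> * (t - t0)) * (D 1 0 t x - D 1 2 t x))
          = (LINT y|lborel. a y * (\<Phi> 1 0 t y - \<Phi> 1 2 t y))"
        using shift[of a t "\<lambda>x. D 1 0 t x - D 1 2 t x"] by (simp add: \<Phi>_def)
      then show ?thesis
        using a'\<Phi>int[of 1 0 t] a'\<Phi>int[of 1 2 t] by (simp add: S_def right_diff_distrib a'\<Phi>)
    qed
    then show ?thesis
      unfolding pair_def set_lebesgue_integral_def
      by (intro Bochner_Integration.integral_cong) (auto simp: indicator_def S_def \<Phi>0)
  qed
  define G2 G3 G4 where "G2 t = (LINT y|lborel. ax y * (b y + c y) * \<Phi> 0 2 t y)"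
    and "G3 t = (LINT y|lborel. (a y)\<^sup>2 * \<Phi> 0 3 t y)"
    and "G4 t = (LINT y|lborel. quadratic_terms a ax b bx c cx y * \<Phi> 0 1 t y)" for t
  have "integrable lborel (\<lambda>y. ax y * (b y + c y))"
    by (rule L2_mult_integrable[OF L(2) L2_add[OF L(3,5)]])
  then have i2: "integrable lborel G2" unfolding G2_def[abs_def] by (rule int1)
  have "integrable lborel (\<lambda>y. (a y)\<^sup>2)" using L(1) by (simp add: L2_def)
  then have i3: "integrable lborel G3" unfolding G3_def[abs_def] by (rule int1)
  have "integrable lborel (quadratic_terms a ax b bx c cx)"
    using L1_curve_quadratic_terms[OF L[THEN L2_curve_const]] unfolding L1_curve_def by (meson order_refl)
  then have i4: "integrable lborel G4" unfolding G4_def[abs_def] by (rule int1)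
  \<comment> \<open>The stationary identity is applied to each time slice of \<open>\<Phi>\<close>,
    which is a test function in \<open>y\<close>.\<close>
  have G: "G2 t - 1/2 * G3 t + G4 t = \<kappa> * (S 0 1 t - S 0 3 t)" for t
  proof -
    have "G2 t - 1/2 * G3 t + G4 t = flux a ax b bx c cx (\<lambda>j. \<Phi> 0 j t)"
      by (simp add: flux_def G2_def G3_def G4_def)
    also have "\<dots> = \<kappa> * momentum a (\<lambda>j. \<Phi> 0 (Suc j) t)" by (rule stat[OF \<Phi>test])
    also have "momentum a (\<lambda>j. \<Phi> 0 (Suc j) t) = S 0 1 t - S 0 3 t"
      unfolding momentum_def S_def using a'\<Phi>int[of 0 1 t] a'\<Phi>int[of 0 3 t]
      by (simp add: right_diff_distrib a'\<Phi> numeral_3_eq_3)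
    finally show ?thesis .
  qed
  define \<Psi> where "\<Psi> t y = \<Phi> 0 0 t y - \<Phi> 0 2 t y" for t y
  define \<Psi>' where "\<Psi>' t y = (\<Phi> 1 0 t y - \<Phi> 1 2 t y) + \<kappa> * (\<Phi> 0 1 t y - \<Phi> 0 3 t y)" for t y
  have \<Psi>_DERIV: "((\<lambda>t. \<Psi> t y) has_real_derivative \<Psi>' t y) (at t)" for t y
  proof -
    have "((\<lambda>t. \<Phi> 0 j t y) has_real_derivative \<Phi> 1 j t y + \<kappa> * \<Phi> 0 (Suc j) t y) (at t)" for j
      unfolding \<Phi>_def using test2_DERIV[OF D, of 0 j] test2_DERIV(3)[OF D, of 1 j]
      by (intro DERIV_along_line[where ft="D 1 j" and fx="D 0 (Suc j)"]) simp_all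
    from DERIV_diff[OF this[of 0] this[of 2]] show ?thesis
      unfolding \<Psi>_def \<Psi>'_def by (simp add: algebra_simps numeral_3_eq_3 numeral_2_eq_2)
  qed
  have \<Psi>'cont: "continuous_on UNIV (\<lambda>t. \<Psi>' t y)" for y
  proof -
    have "continuous_on UNIV (\<lambda>t::real. (t, y))" by (intro continuous_intros)
    then have "continuous_on UNIV (\<lambda>t. \<Phi> i j t y)" for i j
      using continuous_on_compose2[OF \<Phi>cont[of i j], of UNIV "\<lambda>t. (t, y)"] by simp
    then show ?thesis unfolding \<Psi>'_def by (intro continuous_intros)
  qed
  have \<Psi>'int: "(LINT t|lborel. \<Psi>' t y) = 0" for y
  proof -
    \<comment> \<open>The vanishing of \<open>\<Phi>\<close> is known only for times strictly beyond
      \<open>B\<close>, hence the upper end \<open>B + 1\<close>, at which \<open>\<Psi>\<close> is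
      certainly zero.\<close>
    have "\<Psi>' t y = 0" if "t \<notin> {0..B + 1}" for t
    proof -
      have "t \<le> 0 \<or> t > B \<or> \<bar>y\<bar> > R" using that by auto
      then show ?thesis by (simp add: \<Psi>'_def \<Phi>0)
    qed
    then have "(LINT t|lborel. \<Psi>' t y) = (LINT t|lborel. \<Psi>' t y * indicator {0..B + 1} t)"
      by (intro Bochner_Integration.integral_cong) (auto simp: indicator_def)
    also have "\<dots> = \<Psi> (B + 1) y - \<Psi> 0 y"
      by (rule integral_FTC_Icc_real)
         (use B(1) \<Psi>_DERIV \<Psi>'cont[of y] in \<open>auto simp: continuous_on_eq_continuous_at\<close>)
    also have "\<dots> = 0" using \<Phi>0 by (simp add: \<Psi>_def)
    finally show ?thesis .
  qed
  have a'\<Psi>': "(LINT y|lborel. a' y * \<Psi>' t y) = (S 1 0 t - S 1 2 t) + \<kappa> * (S 0 1 t - S 0 3 t)" for t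
  proof -
    have "(LINT y|lborel. a' y * \<Psi>' t y)
        = (LINT y|lborel. (a' y * \<Phi> 1 0 t y - a' y * \<Phi> 1 2 t y) + \<kappa> * (a' y * \<Phi> 0 1 t y - a' y * \<Phi> 0 3 t y))"
      by (simp add: \<Psi>'_def algebra_simps)
    then show ?thesis
      using a'\<Phi>int[of 1 0 t] a'\<Phi>int[of 1 2 t] a'\<Phi>int[of 0 1 t] a'\<Phi>int[of 0 3 t] by (simp add: S_def)
  qed
  have "integrable (lborel \<Otimes>\<^sub>M lborel) (\<lambda>p. ((case p of (t, y) \<Rightarrow> a' y * \<Phi> 1 0 t y) - (case p of (t, y) \<Rightarrow> a' y * \<Phi> 1 2 t y))
      + \<kappa> * ((case p of (t, y) \<Rightarrow> a' y * \<Phi> 0 1 t y) - (case p of (t, y) \<Rightarrow> a' y * \<Phi> 0 3 t y)))"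
    by (intro Bochner_Integration.integrable_add Bochner_Integration.integrable_diff integrable_mult_right int2[OF a'int])
  then have i\<Psi>: "integrable (lborel \<Otimes>\<^sub>M lborel) (\<lambda>(t, y). a' y * \<Psi>' t y)"
    by (rule Bochner_Integration.integrable_cong[THEN iffD1, rotated -1]) (auto simp: \<Psi>'_def algebra_simps)
  \<comment> \<open>After the exchange, \<open>a' y\<close> is constant in the inner integral, which
    is the time integral of a total derivative.\<close>
  have "(LINT t|lborel. LINT y|lborel. a' y * \<Psi>' t y) = (LINT y|lborel. LINT t|lborel. a' y * \<Psi>' t y)"
    by (rule lborel_pair.Fubini_integral[OF i\<Psi>, symmetric])
  also have "\<dots> = 0" by (simp add: \<Psi>'int)
  finally have total: "(LINT t|lborel. (S 1 0 t - S 1 2 t) + \<kappa> * (S 0 1 t - S 0 3 t)) = 0"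
    by (simp only: a'\<Psi>')
  have "(LINT t|lborel. S 1 0 t - S 1 2 t) + (LINT t|lborel. G2 t) - 1/2 * (LINT t|lborel. G3 t) + (LINT t|lborel. G4 t)
      = (LINT t|lborel. (S 1 0 t - S 1 2 t) + (G2 t - 1/2 * G3 t + G4 t))"
    using Sint[of 1 0] Sint[of 1 2] i2 i3 i4 by simp
  also have "\<dots> = 0" unfolding G by (rule total)
  finally have sum0: "(LINT t|lborel. S 1 0 t - S 1 2 t) + (LINT t|lborel. G2 t)
      - 1/2 * (LINT t|lborel. G3 t) + (LINT t|lborel. G4 t) = 0" .
  have qt: "quadratic_terms (\<lambda>x. a (x - s)) (\<lambda>x. ax (x - s)) (\<lambda>x. b (x - s)) (\<lambda>x. bx (x - s))
      (\<lambda>x. c (x - s)) (\<lambda>x. cx (x - s)) = (\<lambda>x. quadratic_terms a ax b bx c cx (x - s))" for s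
    by (rule ext) (simp add: quadratic_terms_def)
  have p2: "pair (\<lambda>t x. ax (x - \<kappa> * (t - t0)) * (b (x - \<kappa> * (t - t0)) + c (x - \<kappa> * (t - t0)))) (D 0 2)
      = (LINT t|lborel. G2 t)"
    using pairD[of "\<lambda>y. ax y * (b y + c y)" 0 2] by (simp only: G2_def)
  have p3: "pair (\<lambda>t x. (a (x - \<kappa> * (t - t0)))\<^sup>2) (D 0 3) = (LINT t|lborel. G3 t)"
    using pairD[of "\<lambda>y. (a y)\<^sup>2" 0 3] by (simp only: G3_def)
  have p4: "pair (\<lambda>t x. quadratic_terms a ax b bx c cx (x - \<kappa> * (t - t0))) (D 0 1) = (LINT t|lborel. G4 t)"
    using pairD[of "quadratic_terms a ax b bx c cx" 0 1] by (simp only: G4_def)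
  show ?thesis unfolding weak_eq_alt qt p1 p2 p3 p4 by (rule sum0)
qed

lemma CH1_travelling:
  assumes "L2 f" "L2 g" "weak_deriv f g"
  shows "CH1 (\<lambda>t x. f (x - \<kappa> * (t - t0))) (\<lambda>t x. g (x - \<kappa> * (t - t0)))"
  unfolding CH1_iff
  using L2_curve_travelling[OF assms(1)] L2_curve_travelling[OF assms(2)]
    weak_deriv_affine[OF assms(3), of 1 "- (\<kappa> * (t - t0))" for t] by simp

theorem theorem4p1:
  fixes u v w :: "real \<Rightarrow> real \<Rightarrow> real"
  assumes sol: "weak_solution u v w"
    and sym: "x_symmetric u v w"
    and uniq: "\<And>u' v' w' t0. weak_solution u' v' w' \<Longrightarrow> t0 \<ge> 0 \<Longrightarrow>
                 (AE x in lborel. u' t0 x = u t0 x \<and> v' t0 x = v t0 x \<and> w' t0 x = w t0 x) \<Longrightarrow>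
                 (\<forall>t\<ge>0. AE x in lborel. u' t x = u t x \<and> v' t x = v t x \<and> w' t x = w t x)"
  shows "\<exists>c t0 (Z :: real \<Rightarrow> real \<times> real \<times> real). t0 \<ge> 0 \<and>
           (\<forall>t\<ge>0. AE x in lborel. (u t x, v t x, w t x) = Z (x - c * (t - t0)))"
proof -
  obtain ux vx wx where C: "CH1 u ux" "CH1 v vx" "CH1 w wx"
    and weak: "\<And>D. test2 D \<Longrightarrow> weak_eq u ux v vx w wx D" "\<And>D. test2 D \<Longrightarrow> weak_eq v vx u ux w wx D"
      "\<And>D. test2 D \<Longrightarrow> weak_eq w wx u ux v vx D"
    using sol unfolding weak_solution_def by blast
  obtain \<beta> \<beta>' where \<beta>: "\<And>t. t \<ge> 0 \<Longrightarrow> (\<beta> has_real_derivative \<beta>' t) (at t within {0..})"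
    and refl: "\<And>t. t \<ge> 0 \<Longrightarrow> AE x in lborel. u t x = u t (2 * \<beta> t - x) \<and> v t x = v t (2 * \<beta> t - x)
                              \<and> w t x = w t (2 * \<beta> t - x)"
    using sym unfolding x_symmetric_def by blast
  have su: "AE x in lborel. u t x = u t (2 * \<beta> t - x)" and sv: "AE x in lborel. v t x = v t (2 * \<beta> t - x)"
    and sw: "AE x in lborel. w t x = w t (2 * \<beta> t - x)" if "t \<ge> 0" for t
    using refl[OF that] by (eventually_elim, simp)+
  \<comment> \<open>Time 1 stands for an arbitrary positive time: the equation yields a time
    derivative only inside the open half-line, and there the one-sided derivative of
    \<open>\<beta>\<close> is two-sided.\<close>
  define \<kappa> where "\<kappa> = \<beta>' 1"
  have "(\<beta> has_real_derivative \<kappa>) (at 1 within {0..})" using \<beta>[of 1] by (simp add: \<kappa>_def)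
  then have d\<beta>: "(\<beta> has_real_derivative \<kappa>) (at 1)"
    using at_within_interior[of "1 :: real" "{0..}"] by (simp add: interior_real_atLeast)
  have curves: "L2_curve u" "L2_curve ux" "L2_curve v" "L2_curve vx" "L2_curve w" "L2_curve wx"
    and wd: "weak_deriv (u 1) (ux 1)" "weak_deriv (v 1) (vx 1)" "weak_deriv (w 1) (wx 1)"
    using C by (auto simp: CH1_iff)
  then have L: "L2 (u 1)" "L2 (ux 1)" "L2 (v 1)" "L2 (vx 1)" "L2 (w 1)" "L2 (wx 1)"
    by (auto simp: L2_curve_def)
  have stat_u: "flux (u 1) (ux 1) (v 1) (vx 1) (w 1) (wx 1) \<eta> = \<kappa> * momentum (u 1) (\<lambda>k. \<eta> (Suc k))"
    if "test_seq \<eta>" for \<eta>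
    by (rule flux_eq_momentum[OF curves weak(1) that _ wd su sv sw d\<beta>]) simp_all
  \<comment> \<open>The same lemma with the roles of the components permuted; the single reflection
    point \<open>\<beta>\<close> is common to all three.\<close>
  have stat_v: "flux (v 1) (vx 1) (u 1) (ux 1) (w 1) (wx 1) \<eta> = \<kappa> * momentum (v 1) (\<lambda>k. \<eta> (Suc k))"
    if "test_seq \<eta>" for \<eta>
    by (rule flux_eq_momentum[OF curves(3,4,1,2,5,6) weak(2) that _ wd(2,1,3) sv su sw d\<beta>]) simp_all
  have stat_w: "flux (w 1) (wx 1) (u 1) (ux 1) (v 1) (vx 1) \<eta> = \<kappa> * momentum (w 1) (\<lambda>k. \<eta> (Suc k))"
    if "test_seq \<eta>" for \<eta>
    by (rule flux_eq_momentum[OF curves(5,6,1,2,3,4) weak(3) that _ wd(3,1,2) sw su sv d\<beta>]) simp_all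
  let ?T = "\<lambda>f t x. f (x - \<kappa> * (t - 1)) :: real"
  have "weak_solution (?T (u 1)) (?T (v 1)) (?T (w 1))"
    unfolding weak_solution_def
  proof (intro exI conjI allI impI)
    show "CH1 (?T (u 1)) (?T (ux 1))" "CH1 (?T (v 1)) (?T (vx 1))" "CH1 (?T (w 1)) (?T (wx 1))"
      using L wd by (simp_all add: CH1_travelling)
    fix D assume D: "test2 D"
    show "weak_eq (?T (u 1)) (?T (ux 1)) (?T (v 1)) (?T (vx 1)) (?T (w 1)) (?T (wx 1)) D"
      by (rule travelling_weak_eq[OF L stat_u D])
    show "weak_eq (?T (v 1)) (?T (vx 1)) (?T (u 1)) (?T (ux 1)) (?T (w 1)) (?T (wx 1)) D"
      by (rule travelling_weak_eq[OF L(3,4,1,2,5,6) stat_v D])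
    show "weak_eq (?T (w 1)) (?T (wx 1)) (?T (u 1)) (?T (ux 1)) (?T (v 1)) (?T (vx 1)) D"
      by (rule travelling_weak_eq[OF L(5,6,1,2,3,4) stat_w D])
  qed
  \<comment> \<open>At time 1 the shift \<open>\<kappa> * (t - 1)\<close> is zero, so the wave and
    the solution coincide there; uniqueness then also covers the earlier times.\<close>
  from uniq[OF this, of 1]
  have same: "\<forall>t\<ge>0. AE x in lborel. ?T (u 1) t x = u t x \<and> ?T (v 1) t x = v t x \<and> ?T (w 1) t x = w t x"
    by simp
  have "AE x in lborel. (u t x, v t x, w t x) = (\<lambda>y. (u 1 y, v 1 y, w 1 y)) (x - \<kappa> * (t - 1))"
    if "t \<ge> 0" for t
    using same[rule_format, OF that] by eventually_elim simp
  then show ?thesis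
    by (intro exI[of _ \<kappa>] exI[of _ "1 :: real"] exI[of _ "\<lambda>y. (u 1 y, v 1 y, w 1 y)"]) simp
qed

end
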